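(* Let $\Omega$ be a non-obtuse triangle in $\mathbb{R}^2$. Suppose that $k:(0,+\infty)\to\mathbb{R}$ is strictly decreasing and satisfies the condition $(C^1_\alpha)$ (with $m=2$) for some $\alpha>1$, and that $k'(r)/r$ is increasing on the interval $(d(\Omega),D(\Omega))$. Then $\Omega$ has a unique $k$-center.
   Context: Triangles are closed, solid and non-degenerate; non-obtuse means every angle is at most $\pi/2$. "Increasing" means non-decreasing. Condition $(C^1_\alpha)$ (for $\alpha>1$, with $m=2$): $k$ is once continuously differentiable on $(0,+\infty)$ and, as $r\to0^+$, $k(r)=O(r^{\alpha-2})$ if $\alpha<2$, $k(r)=O(\log r)$ if $\alpha=2$, $k(r)=O(1)$ if $\alpha>2$; and $k'(r)=O(r^{\alpha-3})$ if $\alpha<3$, $k'(r)=O(\log r)$ if $\alpha=3$, $k'(r)=O(1)$ if $\alpha>3$. Potential: $K_\Omega(x)=\int_\Omega k(|x-y|)\,dy$ for $x\in\mathbb{R}^2$. A point $x\in\mathbb{R}^2$ is a $k$-center of $\Omega$ if it gives the maximum value of $K_\Omega$ on $\mathbb{R}^2$. Minimal unfolded region: for $v\in S^{1}$ and $b\in\mathbb{R}$, let $\mathrm{Refl}_{v,b}$ be the reflection of $\mathbb{R}^2$ in the line $\{z\mid z\cdot v=b\}$, and $\Omega^+_{v,b}=\{z\in\Omega\mid z\cdot v\ge b\}$. Put $l(v)=\min\{a\in\mathbb{R}\mid \forall b\ge a,\ \mathrm{Refl}_{v,b}(\Omega^+_{v,b})\subset\Omega\}$ and $Uf(\Omega)=\bigcap_{v\in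 S^{1}}\{z\in\mathbb{R}^2\mid z\cdot v\le l(v)\}$. It is a non-empty compact convex set. $d(\Omega)=\min\{|z-w| \mid z\in Uf(\Omega),\ w\in\partial\Omega\}$ and $D(\Omega)=\max\{|z-w| \mid z\in Uf(\Omega),\ w\in\partial\Omega\}$. *)

theory Defs
  imports "HOL-Analysis.Analysis" "HOL-Library.Landau_Symbols"
begin

definition vertex_angle :: "real^2 \<Rightarrow> real^2 \<Rightarrow> real^2 \<Rightarrow> real" where
  "vertex_angle A B C = arccos (((B - A) \<bullet> (C - A)) / (norm (B - A) * norm (C - A)))"

definition non_obtuse_triangle :: "(real^2) set \<Rightarrow> bool" where
  "non_obtuse_triangle \<Omega> \<longleftrightarrow>
     (\<exists>A B C. \<not> collinear {A, B, C} \<and> \<Omega> = convex hull {A, B, C} \<and>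
        vertex_angle A B C \<le> pi / 2 \<and>
        vertex_angle B C A \<le> pi / 2 \<and>
        vertex_angle C A B \<le> pi / 2)"

text \<open>
  A kernel defined on the positive reals is represented by a total function on the reals; no
  notion below depends on its values at non-positive arguments. In the potential, the value
  at 0 enters only at the single point where the integration variable meets the base point,
  a null set.
\<close>

definition condition_C1 :: "real \<Rightarrow> (real \<Rightarrow> real) \<Rightarrow> bool" where
  "condition_C1 \<alpha> k \<longleftrightarrow>
     k C1_differentiable_on {0<..} \<and>
     (\<alpha> < 2 \<longrightarrow> k \<in> O[at_right 0](\<lambda>r. r powr (\<alpha> - 2))) \<and>
     (\<alpha> = 2 \<longrightarrow> k \<in> O[at_right 0](\<lambda>r. ln r)) \<and>
     (\<alpha> > 2 \<longrightarrow> k \<in> O[at_right 0](\<lambda>r. 1)) \<and>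
     (\<alpha> < 3 \<longrightarrow> deriv k \<in> O[at_right 0](\<lambda>r. r powr (\<alpha> - 3))) \<and>
     (\<alpha> = 3 \<longrightarrow> deriv k \<in> O[at_right 0](\<lambda>r. ln r)) \<and>
     (\<alpha> > 3 \<longrightarrow> deriv k \<in> O[at_right 0](\<lambda>r. 1))"

definition potential :: "(real \<Rightarrow> real) \<Rightarrow> (real^2) set \<Rightarrow> real^2 \<Rightarrow> real" where
  "potential k \<Omega> x = (LINT y:\<Omega>|lborel. k (dist x y))"

definition is_k_center :: "(real \<Rightarrow> real) \<Rightarrow> (real^2) set \<Rightarrow> real^2 \<Rightarrow> bool" where
  "is_k_center k \<Omega> x \<longleftrightarrow> (\<forall>y. potential k \<Omega> y \<le> potential k \<Omega> x)"

text \<open>The formula is a reflection for unit vectors \<open>v\<close>, the only ones to which it is applied.\<close>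

definition line_reflection :: "real^2 \<Rightarrow> real \<Rightarrow> real^2 \<Rightarrow> real^2" where
  "line_reflection v b z = z - (2 * (z \<bullet> v - b)) *\<^sub>R v"

definition upper_part :: "(real^2) set \<Rightarrow> real^2 \<Rightarrow> real \<Rightarrow> (real^2) set" where
  "upper_part \<Omega> v b = {z \<in> \<Omega>. z \<bullet> v \<ge> b}"

text \<open>
  For non-empty compact \<open>\<Omega>\<close> the set of admissible levels is non-empty, closed and bounded below,
  so its infimum is a minimum. Likewise the infimum and supremum in \<open>inner_dist\<close> and
  \<open>outer_dist\<close> are attained, as the minimal unfolded region and the frontier are then compact
  and non-empty.
\<close>

definition max_fold :: "(real^2) set \<Rightarrow> real^2 \<Rightarrow> real" where
  "max_fold \<Omega> v = Inf {a. \<forall>b\<ge>a. line_reflection v b ` upper_part \<Omega> v b \<subseteq> \<Omega>}"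

definition min_unfolded :: "(real^2) set \<Rightarrow> (real^2) set" where
  "min_unfolded \<Omega> = (\<Inter>v\<in>sphere 0 1. {z. z \<bullet> v \<le> max_fold \<Omega> v})"

definition inner_dist :: "(real^2) set \<Rightarrow> real" where
  "inner_dist \<Omega> = Inf {dist z w |z w. z \<in> min_unfolded \<Omega> \<and> w \<in> frontier \<Omega>}"

definition outer_dist :: "(real^2) set \<Rightarrow> real" where
  "outer_dist \<Omega> = Sup {dist z w |z w. z \<in> min_unfolded \<Omega> \<and> w \<in> frontier \<Omega>}"

end

(*
Write psi(u) = k(sqrt u); since k'(r)/r is increasing, psi is convex and decreasing on the squared
distances between the minimal unfolded region Uf and the boundary. Centers exist because projecting
a point onto the triangle brings it closer to all of its points, and they lie in Uf by reflection.
Folding each vertex onto the opposite side shows that Uf lies in the medial triangle.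

Let p and q be two centers, at abscissas -L and L on the axis through them, and let phi(t) be the
potential at abscissa t. Cutting the triangle into chords parallel to the axis expresses phi'(t) as
a boundary integral of psi, and phi'(t) - phi'(-t) as the boundary integral of
S = psi((x - t)^2 + y^2) - psi((x + t)^2 + y^2) dy. The function S is odd in x and, by convexity,
for x > 0 it decreases when y^2 grows. Pairing x with -x on each edge, and in one configuration two
edges with each other, gives phi'(t) < phi'(-t) for 0 < t < L. Hence phi(t) + phi(-t) is strictly
decreasing on [0, L], which contradicts the maximality of phi(-L) and phi(L).
*)

theory Submission
  imports Defs "HOL-Real_Asymp.Real_Asymp"
begin

section \<open>Isometries of the plane and Lebesgue measure\<close>

text \<open>Squared distances are the right variable because (x + t)^2 + y^2 exceeds (x - t)^2 + y^2
  by 4 x t whatever y is: S is the drop of \<psi> over an interval of fixed length, and y^2 only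
  shifts that interval. Only first derivatives along the axis are compared, at t and -t; they
  involve values of k on the boundary alone, so the singularity of k inside the triangle does no
  harm. The medial triangle is used in three ways. All points strictly between two distinct points
  of it are interior to the triangle, so the boundary integrals are regular for |t| < L. The
  barycentric coordinates of the origin, the midpoint of the centers, are nonnegative, which decides
  on each edge whether the point at abscissa x or the one at -x is farther from the axis. They are
  also at most 1/2, so the origin is a convex combination of the edge midpoints, which restricts the
  signs of the abscissae of these midpoints. The obstacle is an edge whose midpoint falls on the
  wrong side of the origin: pairing x with -x leaves an excess there, and the edge across the
  triangle has to absorb it.\<close>

lemma lborel_distr_vec2:
  "distr (lborel :: (real \<times> real) measure) borel (\<lambda>(u, s). \<chi> i::2. if i = 1 then u else s) = lborel"
  (is "distr _ _ ?g = _")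
proof (rule lborel_eqI[symmetric])
  have g: "continuous_on UNIV ?g"
  proof -
    have "?g = (\<lambda>z. fst z *\<^sub>R axis 1 1 + snd z *\<^sub>R axis 2 1)"
      by (auto simp: fun_eq_iff vec_eq_iff axis_def) (metis exhaust_2)
    then show ?thesis by (auto intro!: continuous_intros)
  qed
  then have gm: "?g \<in> borel_measurable borel"
    by (rule borel_measurable_continuous_onI)
  fix l u :: "real^2" assume lu: "\<And>b. b \<in> Basis \<Longrightarrow> l \<bullet> b \<le> u \<bullet> b"
  have le: "l $ i \<le> u $ i" for i
    using lu[of "axis i 1"] by (simp add: inner_axis)
  have pre: "?g -` box l u = box (l $ 1, l $ 2) (u $ 1, u $ 2)"
    by (auto simp: mem_box_cart mem_box Basis_prod_def forall_2)
  have "emeasure (distr lborel borel ?g) (box l u) = emeasure lborel (box (l $ 1, l $ 2) (u $ 1, u $ 2))"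
    using gm pre by (simp add: emeasure_distr)
  also have "\<dots> = ennreal ((u $ 1 - l $ 1) * (u $ 2 - l $ 2))"
    using le by (subst emeasure_lborel_box)
       (auto simp: Basis_prod_def prod.union_disjoint)
  also have "(u $ 1 - l $ 1) * (u $ 2 - l $ 2) = (\<Prod>b\<in>Basis. (u - l) \<bullet> b)"
  proof -
    have "(\<Prod>b\<in>Basis. (u - l) \<bullet> b) = (\<Prod>i\<in>UNIV. (u - l) $ i)"
      unfolding axis_eq_axis Basis_vec_def
      by (subst prod.UNION_disjoint) (auto simp: axis_eq_axis inner_axis)
    then show ?thesis by (simp add: UNIV_2)
  qed
  finally show "emeasure (distr lborel borel ?g) (box l u) = ennreal (\<Prod>b\<in>Basis. (u - l) \<bullet> b)" .
qed simp

lemma lborel_distr_orthogonal: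
  fixes f :: "real^'n::{finite,wellorder} \<Rightarrow> real^'n::_"
  assumes "orthogonal_transformation f"
  shows "distr lborel borel f = lborel"
proof (rule lborel_eqI[symmetric])
  have "linear f" using assms by (rule orthogonal_transformation_linear)
  then have fm: "f \<in> borel_measurable borel"
    by (intro borel_measurable_continuous_onI linear_continuous_on) (simp add: linear_conv_bounded_linear)
  have i: "orthogonal_transformation (inv f)" using assms by (rule orthogonal_transformation_inv)
  have bij: "bij f" using assms by (rule orthogonal_transformation_bij)
  fix l u :: "real^'n::{finite,wellorder}" assume lu: "\<And>b. b \<in> Basis \<Longrightarrow> l \<bullet> b \<le> u \<bullet> b"
  have meas: "box l u \<in> lmeasurable" by simp
  have "f -` box l u = inv f ` box l u" using bij by (simp add: bij_vimage_eq_inv_image)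
  then have "emeasure (distr lborel borel f) (box l u) = emeasure lebesgue (inv f ` box l u)"
    using fm measurable_sets_borel[OF fm, of "box l u"] by (simp add: emeasure_distr)
  also have "\<dots> = ennreal (measure lebesgue (box l u))"
    using measure_orthogonal_image[OF i meas] measurable_orthogonal_image[OF i meas]
    by (simp add: emeasure_eq_measure2)
  also have "\<dots> = ennreal (\<Prod>b\<in>Basis. (u - l) \<bullet> b)"
    using lu by simp
  finally show "emeasure (distr lborel borel f) (box l u) = ennreal (\<Prod>b\<in>Basis. (u - l) \<bullet> b)" .
qed simp

lemma orthogonal_frame:
  fixes v n :: "real^2"
  assumes "norm v = 1" "norm n = 1" "v \<bullet> n = 0"
  shows "orthogonal_transformation (\<lambda>z::real^2. (z $ 1) *\<^sub>R v + (z $ 2) *\<^sub>R n)"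
proof -
  have vn: "v \<bullet> v = 1" "n \<bullet> n = 1" "n \<bullet> v = 0"
    using assms by (auto simp: norm_eq_1 inner_commute)
  have "linear (\<lambda>z::real^2. (z $ 1) *\<^sub>R v + (z $ 2) *\<^sub>R n)"
    by (rule linearI) (auto simp: algebra_simps)
  moreover have "(a *\<^sub>R v + b *\<^sub>R n) \<bullet> (c *\<^sub>R v + d *\<^sub>R n) = a * c + b * d" for a b c d
    by (simp add: inner_add_left inner_add_right vn assms(3))
  moreover have "z \<bullet> w = z $ 1 * w $ 1 + z $ 2 * w $ 2" for z w :: "real^2"
    by (simp add: inner_vec_def sum_2)
  ultimately show ?thesis
    unfolding orthogonal_transformation_def by simp
qed

text \<open>The map is composed of the coordinate identification, an orthogonal map and a
  translation, each of which preserves Lebesgue measure. It allows later integrals over the plane to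
  be taken in coordinates adapted to a line: the mirror line of a reflection, or the axis through
  two centers.\<close>

lemma lborel_distr_frame:
  fixes v n p :: "real^2"
  assumes "norm v = 1" "norm n = 1" "v \<bullet> n = 0"
  shows "distr (lborel :: (real \<times> real) measure) borel (\<lambda>(u, s). p + u *\<^sub>R v + s *\<^sub>R n) = lborel"
proof -
  define g where "g = (\<lambda>(u::real, s::real). \<chi> i::2. if i = 1 then u else s)"
  define f where "f = (\<lambda>z::real^2. (z $ 1) *\<^sub>R v + (z $ 2) *\<^sub>R n)"
  have fm: "f \<in> borel_measurable borel"
    unfolding f_def by (intro borel_measurable_continuous_onI continuous_intros)
  have gm: "g \<in> borel_measurable borel"
    unfolding g_def case_prod_beta
  proof (intro borel_measurable_continuous_onI continuous_on_vec_lambda)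
    fix i :: 2
    show "continuous_on UNIV (\<lambda>x :: real \<times> real. if i = 1 then fst x else snd x)"
      by (cases "i = 1") (auto intro!: continuous_intros)
  qed
  have "(\<lambda>(u, s). p + u *\<^sub>R v + s *\<^sub>R n) = (+) p \<circ> (f \<circ> g)"
    by (auto simp: f_def g_def fun_eq_iff add.assoc)
  then have "distr lborel borel (\<lambda>(u, s). p + u *\<^sub>R v + s *\<^sub>R n)
      = distr (distr (distr lborel borel g) borel f) borel ((+) p)"
    using fm gm by (simp add: distr_distr comp_assoc)
  also have "\<dots> = lborel"
    using lborel_distr_vec2 lborel_distr_orthogonal[OF orthogonal_frame[OF assms]]
    by (simp add: g_def f_def lborel_distr_plus)
  finally show ?thesis .
qed

lemma
  fixes v n p :: "real^2" and h :: "real^2 \<Rightarrow> real"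
  assumes "norm v = 1" "norm n = 1" "v \<bullet> n = 0" and h: "h \<in> borel_measurable borel"
  shows integral_frame: "(LINT y|lborel. h y) = (LINT (u, s)|lborel. h (p + u *\<^sub>R v + s *\<^sub>R n))"
    and integrable_frame: "integrable lborel h \<longleftrightarrow> integrable lborel (\<lambda>(u, s). h (p + u *\<^sub>R v + s *\<^sub>R n))"
proof -
  let ?F = "\<lambda>(u, s). p + u *\<^sub>R v + s *\<^sub>R n"
  have F: "?F \<in> borel_measurable lborel"
    unfolding case_prod_beta by (auto intro!: borel_measurable_continuous_onI continuous_intros)
  have D: "distr lborel borel ?F = lborel" by (rule lborel_distr_frame[OF assms(1-3)])
  show "(LINT y|lborel. h y) = (LINT (u, s)|lborel. h (p + u *\<^sub>R v + s *\<^sub>R n))"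
    using integral_distr[OF F h] unfolding D case_prod_beta by assumption
  show "integrable lborel h \<longleftrightarrow> integrable lborel (\<lambda>(u, s). h (p + u *\<^sub>R v + s *\<^sub>R n))"
    using integrable_distr_eq[OF F h] unfolding D case_prod_beta by assumption
qed

section \<open>Singular kernels and existence of centers\<close>

text \<open>The three regimes of \<alpha> merge into one power bound. For \<alpha> < 2 the exponent
  is \<beta> = 2 - \<alpha>, which is below 1 because \<alpha> > 1; logarithmic and bounded growth
  are both absorbed by \<beta> = 1/2. Integrability in the plane would only ask for \<beta> < 2;
  with \<beta> < 1 the singularity is integrable even along a line, which the differentiation by
  slices relies on.\<close>

lemma condition_C1_bound:
  assumes "\<alpha> > 1" "condition_C1 \<alpha> k"
  obtains \<beta> where "0 < \<beta>" "\<beta> < 1" "k \<in> O[at_right 0](\<lambda>r. r powr (- \<beta>))"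
proof (cases "\<alpha> < 2")
  case True
  have "k \<in> O[at_right 0](\<lambda>r. r powr (\<alpha> - 2))"
    using True assms by (simp add: condition_C1_def)
  then show ?thesis using True assms by (intro that[of "2 - \<alpha>"]) auto
next
  case False
  have "(\<lambda>r::real. ln r) \<in> O[at_right 0](\<lambda>r. r powr (- (1/2)))" "(\<lambda>r::real. 1::real) \<in> O[at_right 0](\<lambda>r. r powr (- (1/2)))"
    by real_asymp+
  then have "k \<in> O[at_right 0](\<lambda>r. r powr (- (1/2)))"
    using False assms landau_o.big_trans[of k] unfolding condition_C1_def
    by (cases "\<alpha> = 2") auto
  then show ?thesis by (intro that[of "1/2"]) auto
qed

lemma integrable_abs_powr:
  fixes \<beta> R :: real
  assumes "\<beta> < 1"
  shows "integrable lborel (\<lambda>s. indicator {-R..R} s * \<bar>s\<bar> powr (- \<beta>))"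
proof -
  define R' where "R' = max R 0"
  have "(\<lambda>s. s powr (- \<beta>)) absolutely_integrable_on {0..R'}"
    using integrable_on_powr_from_0[of "- \<beta>" R'] assms
    by (subst absolutely_integrable_on_iff_nonneg) (auto simp: R'_def)
  then have 1: "integrable lborel (\<lambda>s. indicator {0..R'} s * s powr (- \<beta>))"
    unfolding set_integrable_def by (subst (asm) integrable_completion) auto
  have 2: "integrable lborel (\<lambda>s. indicator {0..R'} (- s) * (- s) powr (- \<beta>))"
    using lborel_integrable_real_affine_iff[of "-1" "\<lambda>s. indicator {0..R'} s * s powr (- \<beta>)" 0] 1 by simp
  show ?thesis
    by (rule Bochner_Integration.integrable_bound[OF Bochner_Integration.integrable_add[OF 1 2]])
       (auto simp: R'_def indicator_def abs_if split: if_splits)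
qed

locale singular_kernel =
  fixes k :: "real \<Rightarrow> real" and \<beta> :: real
  assumes cont: "continuous_on {0<..} k"
    and anti: "strict_antimono_on {0<..} k"
    and beta: "0 < \<beta>" "\<beta> < 1"
    and big_o: "k \<in> O[at_right 0](\<lambda>r. r powr (- \<beta>))"
begin

lemma antimonoD: "0 < r \<Longrightarrow> r < r' \<Longrightarrow> k r' < k r"
  using anti by (auto simp: monotone_on_def)

lemma antimonoD_le: "0 < r \<Longrightarrow> r \<le> r' \<Longrightarrow> k r' \<le> k r"
  using antimonoD[of r r'] by (cases "r = r'") auto

lemma bound: "\<exists>C\<ge>0. \<forall>r. 0 < r \<and> r \<le> R \<longrightarrow> \<bar>k r\<bar> \<le> C * r powr (- \<beta>)"
proof -
  obtain c where "c > 0" and ev: "eventually (\<lambda>r. norm (k r) \<le> c * norm (r powr (- \<beta>))) (at_right 0)"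
    using big_o by (elim landau_o.bigE)
  obtain e where e: "e > 0" "\<And>r. 0 < r \<Longrightarrow> r < e \<Longrightarrow> \<bar>k r\<bar> \<le> c * r powr (- \<beta>)"
    using ev unfolding eventually_at_right_field by auto
  \<comment> \<open>The constant \<open>c\<close> serves below \<open>e\<close>. From
    \<open>e\<close> up to \<open>max e R\<close> monotonicity keeps the absolute value of
    \<open>k\<close> below \<open>M\<close>, and the factor \<open>(max e R) powr \<beta>\<close>
    compensates the smallest value of \<open>r powr (- \<beta>)\<close> on that range.\<close>
  define M where "M = \<bar>k e\<bar> + \<bar>k (max e R)\<bar>"
  define C where "C = max c (M * (max e R) powr \<beta>)"
  have "\<bar>k r\<bar> \<le> C * r powr (- \<beta>)" if "0 < r" "r \<le> R" for r
  proof (cases "r < e")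
    case True
    then have "\<bar>k r\<bar> \<le> c * r powr (- \<beta>)" using e that by auto
    also have "\<dots> \<le> C * r powr (- \<beta>)" by (intro mult_right_mono) (auto simp: C_def)
    finally show ?thesis .
  next
    case False
    have "k r \<le> k e" "k (max e R) \<le> k r"
      using False that e by (auto intro: antimonoD_le)
    then have "\<bar>k r\<bar> \<le> M" by (auto simp: M_def)
    also have "M = M * r powr \<beta> * r powr (- \<beta>)" using that by (simp add: powr_minus)
    also have "\<dots> \<le> (M * (max e R) powr \<beta>) * r powr (- \<beta>)"
      using that beta by (intro mult_right_mono mult_left_mono powr_mono2) (auto simp: M_def)
    also have "\<dots> \<le> C * r powr (- \<beta>)"
      by (intro mult_right_mono) (auto simp: C_def)
    finally show ?thesis .
  qed
  moreover have "0 \<le> C" using \<open>c > 0\<close> by (auto simp: C_def)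
  ultimately show ?thesis by auto
qed

text \<open>Since \<open>norm (u, s)\<close> is at least \<open>\<bar>s\<bar>\<close>, the power
  bound can be relaxed to one in \<open>s\<close> alone, still integrable because \<beta> < 1.
  Uniformity in \<open>u\<close> is the point: the same kind of \<open>W\<close> gives integrability
  in the plane by Fubini and dominates the difference quotients of the slice integrals.\<close>

lemma dominating:
  "\<exists>W :: real \<Rightarrow> real. integrable lborel W \<and> (\<forall>s. 0 \<le> W s) \<and>
    (\<forall>(u::real) s. s \<noteq> 0 \<and> norm (u, s) \<le> R \<longrightarrow> \<bar>k (norm (u, s))\<bar> \<le> W s)"
proof -
  obtain C where C: "0 \<le> C" "\<And>r. 0 < r \<Longrightarrow> r \<le> R \<Longrightarrow> \<bar>k r\<bar> \<le> C * r powr (- \<beta>)"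
    using bound[of R] by auto
  define W where "W s = C * (indicator {-R..R} s * \<bar>s\<bar> powr (- \<beta>))" for s
  have "integrable lborel W"
    unfolding W_def using integrable_abs_powr[of \<beta>] beta by simp
  moreover have "0 \<le> W s" for s using C by (simp add: W_def)
  moreover have "\<bar>k (norm (u, s))\<bar> \<le> W s" if "s \<noteq> 0" "norm (u, s) \<le> R" for u s :: real
  proof -
    have s: "\<bar>s\<bar> \<le> norm (u, s)" using norm_snd_le[of s u] by simp
    have "\<bar>k (norm (u, s))\<bar> \<le> C * norm (u, s) powr (- \<beta>)" using that by (intro C) (auto simp: zero_prod_def)
    also have "\<dots> \<le> C * \<bar>s\<bar> powr (- \<beta>)"
      using s that beta C by (intro mult_left_mono powr_mono2') auto
    also have "\<dots> = W s" using s that by (auto simp: W_def indicator_def abs_le_iff)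
    finally show ?thesis .
  qed
  ultimately show ?thesis by blast
qed

lemma measurable_norm:
  "(\<lambda>z :: 'a::euclidean_space. k (norm z)) \<in> borel_measurable borel"
  by (rule borel_measurable_continuous_countable_exceptions[of "{0}"])
     (auto intro!: continuous_on_compose2[OF cont] continuous_intros)

lemma measurable_norm' [measurable (raw)]:
  fixes f :: "'b \<Rightarrow> 'a::euclidean_space"
  assumes "f \<in> borel_measurable M"
  shows "(\<lambda>x. k (norm (f x))) \<in> borel_measurable M"
  using measurable_compose[OF assms measurable_norm] .

lemma integrable_near_0_prod:
  "integrable lborel (\<lambda>z :: real \<times> real. indicator (cball 0 R) z * k (norm z))"
proof -
  from dominating[of R] obtain W :: "real \<Rightarrow> real" where W0: "integrable lborel W \<and> (\<forall>s. 0 \<le> W s) \<and>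
    (\<forall>(u::real) s. s \<noteq> 0 \<and> norm (u, s) \<le> R \<longrightarrow> \<bar>k (norm (u, s))\<bar> \<le> W s)"
    by (rule exE)
  then have W: "integrable lborel W" "\<And>s. 0 \<le> W s"
    "\<And>u s. s \<noteq> 0 \<Longrightarrow> norm (u::real, s) \<le> R \<Longrightarrow> \<bar>k (norm (u, s))\<bar> \<le> W s"
    by auto
  note [measurable] = borel_measurable_integrable[OF W(1)]
  have "integrable (lborel \<Otimes>\<^sub>M lborel) (\<lambda>(u, s). indicator {-R..R} u * W s)"
    unfolding case_prod_beta
  proof (rule lborel_pair.Fubini_integrable)
    have "(LBINT s. norm (indicator {-R..R} u * W s)) = indicator {-R..R} u * (LBINT s. W s)" for u :: real
      using W(2) by (simp add: abs_mult)
    moreover have "integrable lborel (indicat_real {-R..R})"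
      by (auto intro!: integrable_real_indicator simp: emeasure_lborel_Icc_eq)
    ultimately show "integrable lborel (\<lambda>u. LBINT s. norm (indicator {-R..R} (fst (u, s)) * W (snd (u, s))))"
      by simp
  qed (use W(1) in simp_all)
  then have "integrable lborel (\<lambda>(u, s). indicator {-R..R} u * W s)"
    by (simp add: lborel_prod)
  then show "integrable lborel (\<lambda>z :: real \<times> real. indicator (cball 0 R) z * k (norm z))"
  proof (rule Bochner_Integration.integrable_bound)
    have "AE z in (lborel :: real measure) \<Otimes>\<^sub>M lborel. snd z \<noteq> (0::real)"
    proof (rule lborel_pair.AE_pair_measure)
      show "{z \<in> space ((lborel :: real measure) \<Otimes>\<^sub>M lborel). snd z \<noteq> (0::real)} \<in> sets (lborel \<Otimes>\<^sub>M lborel)"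
        by measurable
    qed (auto intro: AE_lborel_singleton)
    then have "AE z in lborel :: (real \<times> real) measure. snd z \<noteq> 0"
      unfolding lborel_prod .
    then show "AE z in lborel. norm (indicator (cball 0 R) z * k (norm z))
        \<le> norm (case z of (u, s) \<Rightarrow> indicator {-R..R} u * W s)"
    proof eventually_elim
      case (elim z)
      obtain u s where z: "z = (u, s)" by force
      have "\<bar>u\<bar> \<le> norm (u, s)" using norm_fst_le[of u s] by simp
      then show ?case using W(2)[of s] W(3)[of s u] elim
        by (auto simp: z indicator_def abs_mult abs_le_iff)
    qed
  qed (auto intro!: borel_measurable_times borel_measurable_indicator measurable_norm)
qed

lemma integrable_near_0:
  "integrable lborel (\<lambda>z :: real^2. indicator (cball 0 R) z * k (norm z))"
proof -
  have nrm: "norm (u *\<^sub>R axis 1 1 + s *\<^sub>R axis 2 1 :: real^2) = norm (u, s)" for u s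
    by (simp add: norm_vec_def L2_set_def sum_2 axis_def norm_Pair)
  note integrable_near_0_prod[of R]
  moreover have "(\<lambda>(u, s). indicator (cball 0 R) (0 + u *\<^sub>R axis 1 1 + s *\<^sub>R axis 2 1 :: real^2)
      * k (norm (0 + u *\<^sub>R axis 1 1 + s *\<^sub>R axis 2 1 :: real^2)))
    = (\<lambda>z. indicator (cball 0 R) z * k (norm z))"
    by (auto simp: fun_eq_iff nrm indicator_def)
  moreover have "(\<lambda>z :: real^2. indicator (cball 0 R) z * k (norm z)) \<in> borel_measurable borel"
    by (auto intro!: borel_measurable_times borel_measurable_indicator measurable_norm)
  moreover have "norm (axis 1 1 :: real^2) = 1" "norm (axis 2 1 :: real^2) = 1" "axis 1 1 \<bullet> (axis 2 1 :: real^2) = 0"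
    by (simp_all add: inner_axis_axis)
  ultimately show ?thesis
    using integrable_frame[of "axis 1 1" "axis 2 1" "\<lambda>z. indicator (cball 0 R) z * k (norm z)" 0] by metis
qed

lemma integrable_potential:
  assumes "bounded \<Omega>" "\<Omega> \<in> sets borel"
  shows "integrable lborel (\<lambda>y :: real^2. indicator \<Omega> y * k (dist x y))"
proof -
  obtain R where R: "\<Omega> \<subseteq> cball x R" using assms(1) unfolding bounded_any_center[where a = x] by (metis mem_cball subsetI)
  have "integrable lborel (\<lambda>y. indicator (cball 0 R) (-x + y) * k (norm (-x + y)))"
    using integrable_near_0[of R]
    by (intro integrable_distr[of "(+) (-x)" lborel borel]) (simp_all add: lborel_distr_plus)
  then show ?thesis
    by (rule Bochner_Integration.integrable_bound)
       (use R assms in \<open>auto simp: indicator_def dist_norm norm_minus_commute subset_eq\<close>)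
qed

lemma potential_eq: "potential k \<Omega> x = (LINT z|lborel. indicator \<Omega> (x + z) * k (norm z))"
  if [measurable]: "\<Omega> \<in> sets borel"
proof -
  have "(LINT y|lborel. indicator \<Omega> y * k (dist x y))
    = (LINT y|distr lborel borel ((+) x). indicator \<Omega> y * k (norm (y - x)))"
    by (simp add: lborel_distr_plus dist_norm norm_minus_commute)
  also have "\<dots> = (LINT z|lborel. indicator \<Omega> (x + z) * k (norm z))"
    by (subst integral_distr) auto
  finally show ?thesis by (simp add: potential_def set_lebesgue_integral_def)
qed

text \<open>After the substitution of \<open>potential_eq\<close> the singular factor no longer
  depends on the base point, so a single dominating function works for a whole convergent sequence.
  The base point survives only in the indicator, which is continuous off the frontier, and the
  frontier of a convex set is a null set.\<close>

lemma continuous_potential: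
  assumes "compact \<Omega>" "convex \<Omega>"
  shows "continuous_on UNIV (potential k \<Omega>)"
proof -
  have [measurable]: "\<Omega> \<in> sets borel" using assms(1) by (auto intro: borel_compact)
  have "(\<lambda>n. potential k \<Omega> (X n)) \<longlonglongrightarrow> potential k \<Omega> x" if X: "X \<longlonglongrightarrow> x" for X x
  proof -
    obtain R1 where R1: "\<Omega> \<subseteq> cball 0 R1"
      using compact_imp_bounded[OF assms(1)] unfolding bounded_any_center[where a = 0] by (metis mem_cball subsetI)
    have "bounded (range X)" using X by (rule convergent_imp_bounded)
    then obtain R2 where R2: "\<And>n. norm (X n) \<le> R2" unfolding bounded_iff by auto
    have dom: "integrable lborel (\<lambda>z::real^2. \<bar>indicator (cball 0 (R1 + R2)) z * k (norm z)\<bar>)"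
      by (intro integrable_abs integrable_near_0)
    have "negligible (frontier \<Omega>)" using assms by (simp add: negligible_convex_frontier)
    then have "frontier \<Omega> \<in> null_sets lborel"
      by (simp add: negligible_iff_null_sets null_sets_completion_iff)
    then have "AE z in lborel. z \<notin> frontier \<Omega>" by (rule AE_not_in)
    then have "AE z in distr lborel borel ((+) x). z \<notin> frontier \<Omega>"
      unfolding lborel_distr_plus .
    then have ae: "AE z in lborel. x + z \<notin> frontier \<Omega>"
      by (subst (asm) AE_distr_iff) (auto simp: Collect_neg_eq)
    show ?thesis
      unfolding potential_eq[OF \<open>\<Omega> \<in> sets borel\<close>]
    proof (rule integral_dominated_convergence[OF _ _ dom])
      show "AE z in lborel. (\<lambda>n. indicator \<Omega> (X n + z) * k (norm z)) \<longlonglongrightarrow> indicator \<Omega> (x + z) * k (norm z)"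
        using ae
      proof eventually_elim
        case (elim z)
        then have "isCont (indicator \<Omega> :: _ \<Rightarrow> real) (x + z)"
          by (simp add: isCont_indicator)
        then have "(\<lambda>n. indicator \<Omega> (X n + z) :: real) \<longlonglongrightarrow> indicator \<Omega> (x + z)"
          by (rule isCont_tendsto_compose) (intro tendsto_intros X)
        then show ?case by (intro tendsto_intros)
      qed
      show "AE z in lborel. norm (indicator \<Omega> (X n + z) * k (norm z))
          \<le> \<bar>indicator (cball 0 (R1 + R2)) z * k (norm z)\<bar>" for n
      proof (rule AE_I2)
        fix z
        have "norm z \<le> norm (X n + z) + norm (X n)" by norm
        then have "X n + z \<in> \<Omega> \<Longrightarrow> norm z \<le> R1 + R2" using R1 R2[of n] by force
        then show "norm (indicator \<Omega> (X n + z) * k (norm z))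
          \<le> \<bar>indicator (cball 0 (R1 + R2)) z * k (norm z)\<bar>"
          by (auto simp: indicator_def)
      qed
    qed auto
  qed
  then show ?thesis
    by (simp add: continuous_on_sequentially o_def)
qed

lemma exists_center:
  assumes "compact \<Omega>" "convex \<Omega>" "\<Omega> \<noteq> {}"
  shows "\<exists>x. is_k_center k \<Omega> x"
proof -
  have cl: "closed \<Omega>" using assms by (simp add: compact_imp_closed)
  have [measurable]: "\<Omega> \<in> sets borel" using cl by auto
  have int: "integrable lborel (\<lambda>y. indicator \<Omega> y * k (dist x y))" for x
    using assms compact_imp_bounded by (intro integrable_potential) auto
  obtain x where x: "x \<in> \<Omega>" "\<And>y. y \<in> \<Omega> \<Longrightarrow> potential k \<Omega> y \<le> potential k \<Omega> x"
    using continuous_attains_sup[OF assms(1,3), of "potential k \<Omega>"]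
      continuous_on_subset[OF continuous_potential[OF assms(1,2)]] by blast
  have "potential k \<Omega> y \<le> potential k \<Omega> (closest_point \<Omega> y)" for y
    unfolding potential_def set_lebesgue_integral_def real_scaleR_def
  proof (rule integral_mono_AE[OF int int])
    have "AE z in lborel. z \<noteq> closest_point \<Omega> y" by (rule AE_lborel_singleton)
    then show "AE z in lborel. indicator \<Omega> z * k (dist y z)
        \<le> indicator \<Omega> z * k (dist (closest_point \<Omega> y) z)"
    proof eventually_elim
      case (elim z)
      show ?case
      proof (cases "z \<in> \<Omega>")
        case True
        then have "dist (closest_point \<Omega> y) z \<le> dist y z"
          using closest_point_lipschitz[OF assms(2) cl assms(3), of y z]
          by (simp add: closest_point_self)
        then show ?thesis using elim True by (auto intro!: antimonoD_le)
      qed auto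
    qed
  qed
  moreover have "closest_point \<Omega> y \<in> \<Omega>" for y
    using cl assms(3) by (rule closest_point_in_set)
  ultimately show ?thesis using x(2) unfolding is_k_center_def by (meson order_trans)
qed

end

section \<open>Reflections and the minimal unfolded region\<close>

lemma unit_normal_exists:
  fixes v :: "real^2"
  assumes "norm v = 1"
  obtains n :: "real^2" where "norm n = 1" "v \<bullet> n = 0"
proof
  let ?n = "(\<chi> i. if i = 1 then - (v $ 2) else v $ 1) :: real^2"
  show "norm ?n = 1" using assms by (simp add: norm_vec_def L2_set_def sum_2 add.commute)
  show "v \<bullet> ?n = 0" by (simp add: inner_vec_def sum_2)
qed

lemma line_reflection_frame:
  assumes "norm v = 1" "v \<bullet> n = 0"
  shows "line_reflection v b (b *\<^sub>R v + u *\<^sub>R v + s *\<^sub>R n) = b *\<^sub>R v + (- u) *\<^sub>R v + s *\<^sub>R n"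
proof -
  have "v \<bullet> v = 1" "n \<bullet> v = 0" using assms by (auto simp: norm_eq_1 inner_commute)
  then show ?thesis
    by (simp add: line_reflection_def inner_add_left algebra_simps flip: scaleR_add_left)
qed

lemma line_reflection_involution:
  assumes "norm v = 1"
  shows "line_reflection v b (line_reflection v b z) = z"
  using assms by (simp add: line_reflection_def inner_diff_left norm_eq_1 algebra_simps flip: scaleR_add_left)

lemma line_reflection_level:
  assumes "norm v = 1"
  shows "line_reflection v b z \<bullet> v = 2 * b - z \<bullet> v"
  using assms by (simp add: line_reflection_def inner_diff_left norm_eq_1)

lemma dist_line_reflection_sq:
  assumes "norm v = 1"
  shows "(dist (line_reflection v b x) y)\<^sup>2 = (dist x y)\<^sup>2 + 4 * (x \<bullet> v - b) * (y \<bullet> v - b)"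
proof -
  let ?c = "x \<bullet> v - b"
  have "v \<bullet> v = 1" using assms by (simp add: norm_eq_1)
  have expand: "(norm (w - c *\<^sub>R v))\<^sup>2 = (norm w)\<^sup>2 - 2 * c * (w \<bullet> v) + c\<^sup>2 * (v \<bullet> v)" for w and c :: real
    unfolding power2_norm_eq_inner
    by (simp add: inner_diff_left inner_diff_right inner_commute[of v w] power2_eq_square algebra_simps)
  have "line_reflection v b x - y = (x - y) - (2 * ?c) *\<^sub>R v"
    by (simp add: line_reflection_def)
  then have "(dist (line_reflection v b x) y)\<^sup>2
      = (norm (x - y))\<^sup>2 - 2 * (2 * ?c) * ((x - y) \<bullet> v) + (2 * ?c)\<^sup>2 * (v \<bullet> v)"
    by (simp only: dist_norm expand)
  also have "\<dots> = (dist x y)\<^sup>2 + 4 * ?c * (y \<bullet> v - b)"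
    by (simp add: \<open>v \<bullet> v = 1\<close> dist_norm inner_diff_left) (simp add: power2_eq_square algebra_simps)
  finally show ?thesis .
qed

lemma dist_line_reflection_cancel:
  assumes "norm v = 1"
  shows "dist (line_reflection v b x) (line_reflection v b y) = dist x y"
proof -
  have "(dist (line_reflection v b x) (line_reflection v b y))\<^sup>2 = (dist x y)\<^sup>2"
    using dist_line_reflection_sq[OF assms, of b x "line_reflection v b y"]
      dist_line_reflection_sq[OF assms, of b y x] line_reflection_level[OF assms, of b y]
    by (simp add: dist_commute algebra_simps)
  then show ?thesis by (simp add: power2_eq_iff_nonneg)
qed

lemma measurable_line_reflection [measurable]: "line_reflection v b \<in> borel_measurable borel"
  unfolding line_reflection_def by (intro borel_measurable_continuous_onI continuous_intros)

text \<open>In a frame based at \<open>b *\<^sub>R v\<close>, a point of the mirror line, the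
  reflection replaces \<open>v\<close> by \<open>- v\<close>. Since \<open>- v\<close> and
  \<open>n\<close> again form an orthonormal frame, both integrals reduce to the same integral in
  coordinates.\<close>

lemma
  fixes h :: "real^2 \<Rightarrow> real"
  assumes v: "norm v = 1" and [measurable]: "h \<in> borel_measurable borel"
  shows integral_line_reflection: "(LINT y|lborel. h (line_reflection v b y)) = (LINT y|lborel. h y)"
    and integrable_line_reflection: "integrable lborel (\<lambda>y. h (line_reflection v b y)) \<longleftrightarrow> integrable lborel h"
proof -
  obtain n where n: "norm n = 1" "v \<bullet> n = 0" using unit_normal_exists[OF v] .
  have v': "norm (- v) = 1" "(- v) \<bullet> n = 0" using v n by auto
  have eq: "h (line_reflection v b (b *\<^sub>R v + u *\<^sub>R (- v) + s *\<^sub>R n)) = h (b *\<^sub>R v + u *\<^sub>R v + s *\<^sub>R n)" for u s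
    using line_reflection_frame[OF v n(2), of b "- u" s] by simp
  have m: "(\<lambda>y. h (line_reflection v b y)) \<in> borel_measurable borel" by measurable
  show "(LINT y|lborel. h (line_reflection v b y)) = (LINT y|lborel. h y)"
    using integral_frame[OF v n, of h "b *\<^sub>R v"] integral_frame[OF v'(1) n(1) v'(2) m, of "b *\<^sub>R v"]
    unfolding eq by simp
  show "integrable lborel (\<lambda>y. h (line_reflection v b y)) \<longleftrightarrow> integrable lborel h"
    using integrable_frame[OF v n, of h "b *\<^sub>R v"] integrable_frame[OF v'(1) n(1) v'(2) m, of "b *\<^sub>R v"]
    unfolding eq by simp
qed

context singular_kernel
begin

text \<open>If x lies beyond the fold level in direction v, its mirror image in a slightly lower
  line is closer to everything below that line. The part of \<Omega> above the line folds into
  \<Omega>, so what it loses is recovered from its mirror image, and an open part of \<Omega>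
  without mirror partner makes the gain strict.\<close>

lemma center_in_min_unfolded:
  assumes comp: "compact \<Omega>" and conv: "convex \<Omega>" and ne: "interior \<Omega> \<noteq> {}" and cen: "is_k_center k \<Omega> x"
  shows "x \<in> min_unfolded \<Omega>"
proof (rule ccontr)
  have [measurable]: "\<Omega> \<in> sets borel" using comp by (auto intro: borel_compact)
  assume "x \<notin> min_unfolded \<Omega>"
  then obtain v where v: "norm v = 1" and xv: "max_fold \<Omega> v < x \<bullet> v"
    by (force simp: min_unfolded_def)
  have "\<Omega> \<noteq> {}" using ne interior_subset by blast
  have cv: "continuous_on \<Omega> (\<lambda>y. y \<bullet> v)" by (intro continuous_intros)
  obtain z1 where z1: "z1 \<in> \<Omega>" "\<And>y. y \<in> \<Omega> \<Longrightarrow> y \<bullet> v \<le> z1 \<bullet> v"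
    using continuous_attains_sup[OF comp \<open>\<Omega> \<noteq> {}\<close> cv] by auto
  obtain z0 where z0: "z0 \<in> \<Omega>" "\<And>y. y \<in> \<Omega> \<Longrightarrow> z0 \<bullet> v \<le> y \<bullet> v"
    using continuous_attains_inf[OF comp \<open>\<Omega> \<noteq> {}\<close> cv] by auto
  let ?S = "{a. \<forall>b\<ge>a. line_reflection v b ` upper_part \<Omega> v b \<subseteq> \<Omega>}"
  have "z1 \<bullet> v + 1 \<in> ?S" using z1(2) by (force simp: upper_part_def)
  then obtain a where a: "a \<in> ?S" "a < x \<bullet> v"
    using cInf_lessD[of ?S "x \<bullet> v"] xv by (auto simp: max_fold_def)
  \<comment> \<open>The level is strictly below x, so that the reflection moves x, and strictly
    above the admissible level \<open>a\<close>, which is what leaves an unpaired part of \<Omega>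
    at the bottom.\<close>
  define b where "b = (a + x \<bullet> v) / 2"
  have b: "a < b" "b < x \<bullet> v" using a by (auto simp: b_def)
  let ?R = "line_reflection v b"
  define D where "D y = k (dist (?R x) y) - k (dist x y)" for y
  have [measurable]: "D \<in> borel_measurable borel" unfolding D_def dist_norm by measurable
  have D_refl: "D (?R y) = - D y" for y
    using dist_line_reflection_cancel[OF v, of b x y] dist_line_reflection_cancel[OF v, of b "?R x" y]
    by (simp add: D_def line_reflection_involution[OF v])
  have D_pos: "D y > 0" if "y \<bullet> v < b" "y \<noteq> ?R x" for y
  proof -
    have "(x \<bullet> v - b) * (y \<bullet> v - b) < 0" using that b by (simp add: mult_pos_neg)
    then have "(dist (?R x) y)\<^sup>2 < (dist x y)\<^sup>2"
      using dist_line_reflection_sq[OF v, of b x y] by (simp only: mult.assoc)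
    then have "dist (?R x) y < dist x y" by (rule power2_less_imp_less) simp
    then show ?thesis using that antimonoD[of "dist (?R x) y" "dist x y"] by (simp add: D_def)
  qed
  have D_0: "D y = 0" if "y \<bullet> v = b" for y
    using dist_line_reflection_sq[OF v, of b x y] that by (simp add: D_def power2_eq_iff_nonneg)
  have int: "integrable lborel (\<lambda>y. indicator \<Omega> y * k (dist w y))" for w
    using comp by (intro integrable_potential compact_imp_bounded) auto
  have intD: "integrable lborel (\<lambda>y. indicator \<Omega> y * D y)"
    using Bochner_Integration.integrable_diff[OF int[of "?R x"] int[of x]] by (simp add: D_def algebra_simps)
  let ?L = "{y :: real^2. y \<bullet> v < b}" and ?U = "{y :: real^2. b \<le> y \<bullet> v}"
  have [measurable]: "?L \<in> sets borel" "?U \<in> sets borel"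
    by (auto intro!: borel_open borel_closed open_Collect_less closed_Collect_le continuous_intros)
  have intL: "integrable lborel (\<lambda>y. indicator ?L y * (indicator \<Omega> y * D y))"
    by (rule Bochner_Integration.integrable_bound[OF intD]) (auto simp: indicator_def)
  have intU: "integrable lborel (\<lambda>y. indicator ?U y * (indicator \<Omega> y * D y))"
    by (rule Bochner_Integration.integrable_bound[OF intD]) (auto simp: indicator_def)
  \<comment> \<open>\<open>G\<close> adds to the contribution of a point below the line that of its
    mirror image. As \<open>D\<close> is odd under the reflection, only the difference of the two
    indicators remains as a factor. On the line itself \<open>D\<close> vanishes, so the closed
    half-plane causes no discrepancy.\<close>
  define G where "G y = indicator ?L y * (indicator \<Omega> y * D y)
      + indicator ?U (?R y) * (indicator \<Omega> (?R y) * D (?R y))" for y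
  have intU': "integrable lborel (\<lambda>y. indicator ?U (?R y) * (indicator \<Omega> (?R y) * D (?R y)))"
    using integrable_line_reflection[OF v, of "\<lambda>y. indicator ?U y * (indicator \<Omega> y * D y)"] intU by simp
  have intG: "integrable lborel G"
    unfolding G_def by (intro Bochner_Integration.integrable_add intL intU')
  have "potential k \<Omega> (?R x) - potential k \<Omega> x = (LINT y|lborel. indicator \<Omega> y * D y)"
    using Bochner_Integration.integral_diff[OF int[of "?R x"] int[of x]]
    by (simp add: potential_def set_lebesgue_integral_def D_def algebra_simps)
  also have "\<dots> = (LINT y|lborel. indicator ?L y * (indicator \<Omega> y * D y) + indicator ?U y * (indicator \<Omega> y * D y))"
    by (intro Bochner_Integration.integral_cong) (auto simp: indicator_def)
  also have "\<dots> = (LINT y|lborel. indicator ?L y * (indicator \<Omega> y * D y)) + (LINT y|lborel. indicator ?U y * (indicator \<Omega> y * D y))"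
    using intL intU by simp
  also have "(LINT y|lborel. indicator ?U y * (indicator \<Omega> y * D y))
      = (LINT y|lborel. indicator ?U (?R y) * (indicator \<Omega> (?R y) * D (?R y)))"
    by (rule integral_line_reflection[OF v, symmetric]) simp
  also have "(LINT y|lborel. indicator ?L y * (indicator \<Omega> y * D y)) + \<dots> = (LINT y|lborel. G y)"
    unfolding G_def using intL intU' by simp
  finally have pot: "potential k \<Omega> (?R x) - potential k \<Omega> x = (LINT y|lborel. G y)" .
  have G_eq: "G y = indicator ?L y * ((indicator \<Omega> y - indicator \<Omega> (?R y)) * D y)" for y
    unfolding G_def D_refl using line_reflection_level[OF v, of b y] D_0[of y]
    by (auto simp: indicator_def)
  have refl_mem: "y \<in> \<Omega>" if "?R y \<in> \<Omega>" "y \<bullet> v < b" for y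
  proof -
    have "?R y \<in> upper_part \<Omega> v b"
      using that line_reflection_level[OF v, of b y] by (simp add: upper_part_def)
    moreover have "?R ` upper_part \<Omega> v b \<subseteq> \<Omega>" using a b by simp
    ultimately have "?R (?R y) \<in> \<Omega>" by blast
    then show ?thesis by (simp add: line_reflection_involution[OF v])
  qed
  have G_nonneg: "G y \<ge> 0" if "y \<noteq> ?R x" for y
    using D_pos[of y] refl_mem[of y] that by (auto simp: G_eq indicator_def)
  have "AE y in lborel. y \<noteq> ?R x" by (rule AE_lborel_singleton)
  then have G_ae: "AE y in lborel. 0 \<le> G y" by eventually_elim (rule G_nonneg)
  have "(LINT y|lborel. G y) \<le> 0"
    using cen[unfolded is_k_center_def, rule_format, of "?R x"] pot by linarith
  moreover have "(LINT y|lborel. G y) \<ge> 0" using G_ae by (rule integral_nonneg_AE)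
  ultimately have "AE y in lborel. G y = 0"
    using integral_nonneg_eq_0_iff_AE[OF intG G_ae] by simp
  then have null: "AE y in lebesgue. G y = 0" by (rule AE_completion)
  \<comment> \<open>Below level \<open>2 * b - z1 \<bullet> v\<close> the mirror image rises above
    the highest point \<open>z1\<close> of \<Omega>, so it lies outside \<Omega>. The point
    \<open>?R x\<close> is removed because \<open>D\<close> would evaluate \<open>k\<close> at 0
    there.\<close>
  define V where "V = {y \<in> interior \<Omega>. y \<bullet> v < min b (2 * b - z1 \<bullet> v)} - {?R x}"
  have V_open: "open V"
    unfolding V_def by (intro open_Diff open_Collect_conj open_Collect_less continuous_intros) auto
  have "V \<noteq> {}"
  proof -
    \<comment> \<open>Folding the highest point at the admissible level \<open>a\<close> lands in
      \<Omega>, hence not below the lowest point \<open>z0\<close>; passing from \<open>a\<close> to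
      the larger \<open>b\<close> makes the inequality strict.\<close>
    have "z0 \<bullet> v < 2 * b - z1 \<bullet> v"
    proof (cases "a \<le> z1 \<bullet> v")
      case True
      then have "line_reflection v a z1 \<in> \<Omega>" using a z1(1) by (auto simp: upper_part_def)
      then have "z0 \<bullet> v \<le> 2 * a - z1 \<bullet> v" using z0(2) line_reflection_level[OF v, of a z1] by metis
      then show ?thesis using b by simp
    next
      case False
      then show ?thesis using z1(2)[OF z0(1)] b by simp
    qed
    moreover have "z0 \<bullet> v \<le> z1 \<bullet> v" using z1(2)[OF z0(1)] .
    ultimately have "z0 \<in> {y. y \<bullet> v < min b (2 * b - z1 \<bullet> v)}" by auto
    moreover have "z0 \<in> closure (interior \<Omega>)"
      using convex_closure_interior[OF conv ne] z0(1) closure_subset by blast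
    moreover have "open {y :: real^2. y \<bullet> v < min b (2 * b - z1 \<bullet> v)}"
      by (intro open_Collect_less continuous_intros)
    ultimately have ne: "{y. y \<bullet> v < min b (2 * b - z1 \<bullet> v)} \<inter> interior \<Omega> \<noteq> {}"
      using open_Int_closure_eq_empty by blast
    have "open ({y. y \<bullet> v < min b (2 * b - z1 \<bullet> v)} \<inter> interior \<Omega>)"
      by (intro open_Int open_Collect_less continuous_intros) auto
    then have "{y. y \<bullet> v < min b (2 * b - z1 \<bullet> v)} \<inter> interior \<Omega> \<noteq> {?R x}"
      using not_open_singleton by metis
    then show ?thesis using ne unfolding V_def by blast
  qed
  have "G y \<noteq> 0" if "y \<in> V" for y
  proof -
    have y: "y \<in> \<Omega>" "y \<bullet> v < b" "y \<bullet> v < 2 * b - z1 \<bullet> v" "y \<noteq> ?R x"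
      using that interior_subset by (auto simp: V_def)
    have "?R y \<notin> \<Omega>" using z1(2)[of "?R y"] y line_reflection_level[OF v, of b y] by auto
    then show ?thesis using y D_pos[of y] by (simp add: G_eq)
  qed
  then have "negligible V"
    using null unfolding negligible_iff_null_sets
    by (auto simp: eventually_ae_filter intro: null_sets_completion_subset elim!: subset_trans[rotated])
  then show False using open_not_negligible[OF V_open \<open>V \<noteq> {}\<close>] by simp
qed

end

text \<open>An infimum of reals is a lower bound only for a set bounded below. The lowest level of
  \<Omega> bounds the admissible levels: a fold strictly below it would send a lowest point to a
  still lower one.\<close>

lemma max_fold_le:
  assumes "compact \<Omega>" "\<Omega> \<noteq> {}" "norm v = 1"
    and a: "\<And>b. a \<le> b \<Longrightarrow> line_reflection v b ` upper_part \<Omega> v b \<subseteq> \<Omega>"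
  shows "max_fold \<Omega> v \<le> a"
proof -
  have "continuous_on \<Omega> (\<lambda>y. y \<bullet> v)" by (intro continuous_intros)
  from continuous_attains_inf[OF assms(1,2) this]
  obtain z where z: "z \<in> \<Omega>" "\<And>y. y \<in> \<Omega> \<Longrightarrow> z \<bullet> v \<le> y \<bullet> v" by auto
  have "z \<bullet> v \<le> a'" if "\<forall>b\<ge>a'. line_reflection v b ` upper_part \<Omega> v b \<subseteq> \<Omega>" for a'
  proof (rule ccontr)
    assume *: "\<not> z \<bullet> v \<le> a'"
    then have "z \<in> upper_part \<Omega> v a'" using z(1) by (simp add: upper_part_def)
    then have "line_reflection v a' z \<in> \<Omega>" using that by blast
    then have "z \<bullet> v \<le> 2 * a' - z \<bullet> v" using z(2) line_reflection_level[OF assms(3), of a' z] by metis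
    then show False using * by simp
  qed
  then show ?thesis
    unfolding max_fold_def using a by (intro cInf_lower bdd_belowI[of _ "z \<bullet> v"]) auto
qed

section \<open>Non-obtuse triangles: the minimal unfolded region and the medial triangle\<close>

lemma inner_nonneg_of_vertex_angle:
  assumes "vertex_angle A B C \<le> pi / 2" "A \<noteq> B" "A \<noteq> C"
  shows "0 \<le> (B - A) \<bullet> (C - A)"
proof (rule ccontr)
  let ?x = "((B - A) \<bullet> (C - A)) / (norm (B - A) * norm (C - A))"
  assume "\<not> 0 \<le> (B - A) \<bullet> (C - A)"
  moreover have pos: "0 < norm (B - A) * norm (C - A)" using assms by simp
  ultimately have "?x < 0" by (simp add: divide_neg_pos)
  moreover have "- 1 \<le> ?x"
    using Cauchy_Schwarz_ineq2[of "B - A" "C - A"] pos by (simp add: pos_le_divide_eq)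
  ultimately have "arccos 0 < arccos ?x" by (intro arccos_less_arccos) auto
  then show False using assms(1) by (simp add: vertex_angle_def)
qed

lemma barycentric_coordinates_exist:
  fixes A B C z :: "real^2"
  assumes "\<not> collinear {A, B, C}"
  obtains a b c where "a + b + c = 1" "z = a *\<^sub>R A + b *\<^sub>R B + c *\<^sub>R C"
proof -
  have "affine hull {A, B, C} = UNIV"
  proof -
    have ind: "\<not> affine_dependent {A, B, C}"
      using assms collinear_3_eq_affine_dependent by blast
    have "card {A, B, C} = 3" using assms by (auto simp: card_insert_if insert_commute)
    then have "aff_dim {A, B, C} = 2"
      using aff_dim_affine_independent[OF ind] by simp
    then show ?thesis by (simp add: aff_dim_eq_full[symmetric])
  qed
  then show ?thesis using that by (auto simp: affine_hull_3 set_eq_iff)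
qed

text \<open>Fold along lines parallel to BC. Because the angles at B and C are not obtuse, the foot
  of the altitude from A lies on the side BC, so moving a point down the altitude direction
  transfers weight from A to B and C in nonnegative proportions. From half the height upwards no
  point has to give away more weight than it has.\<close>

lemma min_unfolded_triangle_half:
  fixes A B C :: "real^2"
  assumes ncol: "\<not> collinear {A, B, C}" and \<Omega>: "\<Omega> = convex hull {A, B, C}"
    and B: "0 \<le> (A - B) \<bullet> (C - B)" and C: "0 \<le> (A - C) \<bullet> (B - C)"
    and z: "a *\<^sub>R A + b *\<^sub>R B + c *\<^sub>R C \<in> min_unfolded \<Omega>" and sum: "a + b + c = 1"
  shows "a \<le> 1 / 2"
proof -
  have "B \<noteq> C" using ncol by auto
  define e where "e = C - B"
  have ee: "e \<bullet> e > 0" using \<open>B \<noteq> C\<close> by (simp add: e_def)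
  \<comment> \<open>The foot of the altitude from A is
    \<open>(1 - \<tau>) *\<^sub>R B + \<tau> *\<^sub>R C\<close>; the angles at B and C give
    \<open>0 \<le> \<tau>\<close> and \<open>\<tau> \<le> 1\<close>. Below, \<open>w\<close> is the
    altitude vector and \<open>H\<close> its length.\<close>
  define \<tau> where "\<tau> = ((A - B) \<bullet> e) / (e \<bullet> e)"
  have "0 \<le> \<tau>" using B ee by (simp add: \<tau>_def e_def)
  have "(A - C) \<bullet> (B - C) = e \<bullet> e - (A - B) \<bullet> e"
    by (simp add: e_def inner_diff_left inner_diff_right inner_commute)
  then have "\<tau> \<le> 1" using C ee by (simp add: \<tau>_def)
  define w where "w = A - B - \<tau> *\<^sub>R e"
  have we: "w \<bullet> e = 0" using ee by (simp add: w_def \<tau>_def inner_diff_left)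
  have "w \<noteq> 0"
  proof
    assume "w = 0"
    then have "A = (1 - \<tau>) *\<^sub>R B + \<tau> *\<^sub>R C" by (simp add: w_def e_def algebra_simps)
    then have "A \<in> affine hull {B, C}" unfolding affine_hull_2 by force
    then have "collinear {B, C, A}" by (simp add: collinear_3_affine_hull \<open>B \<noteq> C\<close>)
    then show False using ncol by (simp add: insert_commute)
  qed
  define H where "H = norm w"
  have H: "H > 0" using \<open>w \<noteq> 0\<close> by (simp add: H_def)
  define v where "v = (1 / H) *\<^sub>R w"
  have v: "norm v = 1" using H by (simp add: v_def H_def)
  have wv: "w = H *\<^sub>R v" using H by (simp add: v_def)
  have ev: "e \<bullet> v = 0" using we by (simp add: v_def inner_commute)
  have Cv: "C \<bullet> v = B \<bullet> v" using ev by (simp add: e_def inner_diff_left)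
  have A: "A = (1 - \<tau>) *\<^sub>R B + \<tau> *\<^sub>R C + H *\<^sub>R v"
    using wv by (simp add: w_def e_def algebra_simps)
  have vv: "v \<bullet> v = 1" using v by (simp add: norm_eq_1)
  have Av: "A \<bullet> v = B \<bullet> v + H"
    by (subst A) (simp add: inner_add_left Cv vv algebra_simps)
  have level: "(x *\<^sub>R A + y *\<^sub>R B + t *\<^sub>R C) \<bullet> v = B \<bullet> v + x * H" if "x + y + t = 1" for x y t
  proof -
    have "(x *\<^sub>R A + y *\<^sub>R B + t *\<^sub>R C) \<bullet> v = (x + y + t) * (B \<bullet> v) + x * H"
      by (simp add: inner_add_left Av Cv algebra_simps)
    then show ?thesis using that by simp
  qed
  have "max_fold \<Omega> v \<le> B \<bullet> v + H / 2"
  proof (rule max_fold_le)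
    show "compact \<Omega>" by (simp add: \<Omega> compact_convex_hull finite_imp_compact)
    show "\<Omega> \<noteq> {}" by (simp add: \<Omega>)
    fix l assume l: "B \<bullet> v + H / 2 \<le> l"
    show "line_reflection v l ` upper_part \<Omega> v l \<subseteq> \<Omega>"
    proof
      fix p assume "p \<in> line_reflection v l ` upper_part \<Omega> v l"
      then obtain y where y: "y \<in> \<Omega>" "l \<le> y \<bullet> v" "p = line_reflection v l y"
        by (auto simp: upper_part_def)
      obtain x1 x2 x3 where x: "0 \<le> x1" "0 \<le> x2" "0 \<le> x3" "x1 + x2 + x3 = 1"
        "y = x1 *\<^sub>R A + x2 *\<^sub>R B + x3 *\<^sub>R C"
        using y(1) by (auto simp: \<Omega> convex_hull_3)
      \<comment> \<open>The reflection moves \<open>y\<close> by \<rho> altitudes, that is, it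
        changes the barycentric coordinates by \<rho> times (-1, 1 - \<tau>, \<tau>). A fold level
        of at least half the height gives \<rho> \<le> 2 x1 - 1, which is at most x1.\<close>
      define \<rho> where "\<rho> = 2 * (y \<bullet> v - l) / H"
      have "y \<bullet> v = B \<bullet> v + x1 * H" using level x by simp
      then have "2 * (y \<bullet> v - l) \<le> x1 * H"
        using l mult_right_mono[of x1 1 H] x(1-4) H by argo
      then have r: "\<rho> \<le> x1" "0 \<le> \<rho>" using y H by (auto simp: \<rho>_def pos_divide_le_eq)
      have "p = y - (\<rho> * H) *\<^sub>R v" using H y by (simp add: \<rho>_def line_reflection_def)
      also have "(\<rho> * H) *\<^sub>R v = \<rho> *\<^sub>R (A - (1 - \<tau>) *\<^sub>R B - \<tau> *\<^sub>R C)"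
        by (subst A) simp
      also have "y - \<dots> = (x1 - \<rho>) *\<^sub>R A + (x2 + \<rho> * (1 - \<tau>)) *\<^sub>R B + (x3 + \<rho> * \<tau>) *\<^sub>R C"
        by (simp add: x(5) algebra_simps)
      finally show "p \<in> \<Omega>"
        unfolding \<Omega> convex_hull_3 mem_Collect_eq using x(1-4) r \<open>0 \<le> \<tau>\<close> \<open>\<tau> \<le> 1\<close>
        apply (rule_tac exI[of _ "x1 - \<rho>"])
        apply (rule_tac exI[of _ "x2 + \<rho> * (1 - \<tau>)"])
        apply (rule_tac exI[of _ "x3 + \<rho> * \<tau>"])
        by (auto simp: algebra_simps intro: order_trans[OF mult_left_le])
    qed
  qed (rule v)
  moreover have "(a *\<^sub>R A + b *\<^sub>R B + c *\<^sub>R C) \<bullet> v \<le> max_fold \<Omega> v"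
    using z v by (auto simp: min_unfolded_def)
  ultimately have "a * H \<le> 1 / 2 * H" using level[OF sum] by simp
  then show ?thesis using H by simp
qed

lemma convex_min_unfolded: "convex (min_unfolded \<Omega>)"
  unfolding min_unfolded_def
  by (intro convex_INT) (simp add: inner_commute[of _ "_ :: real^2"] convex_halfspace_le)

section \<open>Integrals along the edges of a triangle\<close>

lemma integral_unit_interval_affine:
  fixes f :: "real \<Rightarrow> real"
  assumes "a \<le> b" "continuous_on {a..b} f"
  shows "(b - a) * integral {0..1} (\<lambda>x. f (a + x * (b - a))) = integral {a..b} f"
proof -
  have "((\<lambda>x. (b - a) *\<^sub>R f (a + x * (b - a))) has_integral
      (integral {a + 0 * (b - a)..a + 1 * (b - a)} f)) {0..1}"
  proof (rule has_integral_substitution[where c = a and d = b and f = f and g = "\<lambda>x. a + x * (b - a)" and g' = "\<lambda>_. b - a"])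
    show "(\<lambda>x. a + x * (b - a)) ` {0..1} \<subseteq> {a..b}"
    proof (rule image_subsetI)
      fix x :: real assume "x \<in> {0..1}"
      then have "0 \<le> x * (b - a)" "x * (b - a) \<le> 1 * (b - a)"
        using assms(1) mult_right_mono[of x 1 "b - a"] by auto
      then show "a + x * (b - a) \<in> {a..b}" by simp
    qed
  qed (use assms in \<open>auto intro!: derivative_eq_intros\<close>)
  then show ?thesis by (simp add: has_integral_iff)
qed

lemma integral_reflect_interval:
  fixes f :: "real \<Rightarrow> real"
  assumes "a \<le> b" "continuous_on {a..b} f"
  shows "integral {a..b} (\<lambda>x. f (a + b - x)) = integral {a..b} f"
proof -
  have "((\<lambda>x. (- 1) *\<^sub>R f (a + b - x)) has_integral
      (integral {a + b - a..a + b - b} f - integral {a + b - b..a + b - a} f)) {a..b}"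
    using assms
    by (intro has_integral_substitution_general[of "{}" _ _ _ a b])
       (auto intro!: derivative_eq_intros continuous_intros)
  then have "((\<lambda>x. - f (a + b - x)) has_integral (integral {b..a} f - integral {a..b} f)) {a..b}" by simp
  moreover have "integral {b..a} f = 0" using assms(1) by (cases "a = b") auto
  ultimately have "integral {a..b} (\<lambda>x. - f (a + b - x)) = - integral {a..b} f"
    by (simp add: has_integral_iff)
  then show ?thesis by simp
qed

text \<open>The positive part of \<open>f\<close> is compensated by reflection in the zero of \<open>x \<mapsto> p + x d\<close>.\<close>

lemma integral_nonpos_pairing:
  fixes f :: "real \<Rightarrow> real" and p d :: real
  assumes cont: "continuous_on {0..1} f" and d: "0 \<le> d" and mid: "2 * p + d \<le> 0"
    and neg: "\<And>x. x \<in> {0..1} \<Longrightarrow> p + x * d < 0 \<Longrightarrow> f x < 0"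
    and zero: "\<And>x. x \<in> {0..1} \<Longrightarrow> p + x * d = 0 \<Longrightarrow> f x = 0"
    and pair: "\<And>x y. x \<in> {0..1} \<Longrightarrow> y \<in> {0..1} \<Longrightarrow> p + x * d \<ge> 0 \<Longrightarrow> (p + x * d) + (p + y * d) = 0 \<Longrightarrow> f x + f y \<le> 0"
  shows "integral {0..1} f \<le> 0" "2 * p + d < 0 \<Longrightarrow> integral {0..1} f < 0"
proof -
  have *: "integral {0..1} f \<le> 0 \<and> (2 * p + d < 0 \<longrightarrow> integral {0..1} f < 0)"
  proof (cases "p + d \<le> 0")
    case True
    have le: "f x \<le> 0" if "x \<in> {0..1}" for x
    proof -
      have "p + x * d \<le> p + d" using that d mult_right_mono[of x 1 d] by simp
      then show ?thesis using neg[OF that] zero[OF that] True by fastforce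
    qed
    have "integral {0..1} f \<le> integral {0..1::real} (\<lambda>_. 0)"
      by (intro integral_le integrable_continuous_interval cont continuous_intros le)
    moreover have "integral {0..1} f < integral {0..1::real} (\<lambda>_. 0)" if "2 * p + d < 0"
    proof (rule integral_less_real[OF cont])
      fix x :: real assume x: "x \<in> {0<..<1}"
      have "p + x * d < 0"
      proof (cases "d = 0")
        case False
        then have "x * d < 1 * d" using x d by (intro mult_strict_right_mono) auto
        then show ?thesis using True by simp
      qed (use that in simp)
      then show "f x < 0" using neg x by simp
    qed auto
    ultimately show ?thesis by simp
  next
    case False
    then have "d > 0" using mid d by (cases "d = 0") auto
    \<comment> \<open>This is the parameter with \<open>p + c * d = - (p + d)\<close>: reflection in
      the zero exchanges it with the endpoint 1. Hence the zero is the midpoint of [c, 1], where the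
      pairing acts, while the rest [0, c] lies entirely on the negative side.\<close>
    define c where "c = (- 2 * p - d) / d"
    have c: "0 \<le> c" "c < 1" using \<open>d > 0\<close> mid False by (auto simp: c_def field_simps)
    have cd: "c * d = - 2 * p - d" using \<open>d > 0\<close> by (simp add: c_def)
    have cont1: "continuous_on {0..c} f" "continuous_on {c..1} f"
      using c by (auto intro: continuous_on_subset[OF cont])
    have split: "integral {0..1} f = integral {0..c} f + integral {c..1} f"
      using c by (intro Henstock_Kurzweil_Integration.integral_combine[symmetric] integrable_continuous_interval cont) auto
    have "2 * integral {c..1} f = integral {c..1} f + integral {c..1} (\<lambda>x. f (c + 1 - x))"
      using integral_reflect_interval[of c 1 f] c cont1 by simp
    also have "\<dots> = integral {c..1} (\<lambda>x. f x + f (c + 1 - x))"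
      by (intro Henstock_Kurzweil_Integration.integral_add[symmetric] integrable_continuous_interval cont1
           continuous_on_compose2[OF cont1(2)] continuous_intros) auto
    also have "\<dots> \<le> integral {c..1} (\<lambda>_. 0)"
    proof (intro integral_le integrable_continuous_interval)
      fix x assume x: "x \<in> {c..1}"
      have s: "(p + x * d) + (p + (c + 1 - x) * d) = 0" using cd by (simp add: algebra_simps)
      show "f x + f (c + 1 - x) \<le> 0"
      proof (cases "p + x * d \<ge> 0")
        case True
        then show ?thesis using pair[OF _ _ True s] x c by simp
      next
        case False
        then show ?thesis using pair[of "c + 1 - x" x] s x c by simp
      qed
    qed (auto intro!: continuous_intros cont1 continuous_on_compose2[OF cont1(2)])
    finally have 1: "integral {c..1} f \<le> 0" by simp
    have neg': "f x < 0" if "x \<in> {0..c}" for x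
    proof (rule neg)
      have "x * d \<le> c * d" using that \<open>d > 0\<close> by simp
      then show "p + x * d < 0" using cd False by simp
    qed (use that c in auto)
    have "integral {0..c} f \<le> integral {0..c} (\<lambda>_. 0)"
      by (intro integral_le integrable_continuous_interval cont1 continuous_intros less_imp_le neg')
    moreover have "integral {0..c} f < integral {0..c} (\<lambda>_. 0)" if "2 * p + d < 0"
    proof (rule integral_less_real[OF cont1(1)])
      have "c > 0" using that \<open>d > 0\<close> by (simp add: c_def)
      then show "{0<..<c} \<noteq> {}" by simp
    qed (auto intro: neg')
    ultimately show ?thesis using 1 unfolding split by (auto intro: add_nonpos_nonpos add_neg_nonpos)
  qed
  then show "integral {0..1} f \<le> 0" "2 * p + d < 0 \<Longrightarrow> integral {0..1} f < 0" by auto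
qed

text \<open>The points x + h and y both lie between x and y + h, with complementary weights u and 1
  - u. Adding the two convexity inequalities therefore reproduces the endpoint values with weight
  one each.\<close>

lemma convex_on_increments_mono:
  fixes f :: "real \<Rightarrow> real"
  assumes conv: "convex_on I f" and xy: "x \<le> y" "x \<in> I" "y + h \<in> I" and h: "0 \<le> h"
  shows "f (x + h) + f y \<le> f x + f (y + h)"
proof (cases "y + h - x = 0")
  case True
  then have "h = 0" "y = x" using xy h by auto
  then show ?thesis by simp
next
  case False
  then have pos: "y + h - x > 0" using xy h by simp
  define u where "u = h / (y + h - x)"
  have u: "0 \<le> u" "u \<le> 1" "u * (y + h - x) = h" using pos xy h by (auto simp: u_def)
  have e1: "x + h = (1 - u) * x + u * (y + h)" and e2: "y = u * x + (1 - u) * (y + h)"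
    using u(3) by (auto simp: algebra_simps)
  have "f (x + h) \<le> (1 - u) * f x + u * f (y + h)" "f y \<le> u * f x + (1 - u) * f (y + h)"
    using convex_onD[OF conv u(1,2) xy(2,3)] convex_onD[OF conv _ _ xy(2,3), of "1 - u"] u(1,2)
    unfolding real_scaleR_def by (subst e1, simp, subst e2, simp)
  then show ?thesis by (simp add: algebra_simps)
qed

section \<open>The boundary integral of \<open>S\<close> on a segment and around a triangle\<close>

locale convex_profile =
  fixes \<psi> :: "real \<Rightarrow> real" and I :: "real set" and t :: real
  assumes conv: "convex_on I \<psi>" and anti: "strict_antimono_on I \<psi>" and cont: "continuous_on I \<psi>"
    and t: "t > 0"
begin

definition S :: "real \<Rightarrow> real \<Rightarrow> real" where
  "S x y = \<psi> ((x - t)\<^sup>2 + y\<^sup>2) - \<psi> ((x + t)\<^sup>2 + y\<^sup>2)"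

definition good :: "real \<Rightarrow> real \<Rightarrow> bool" where
  "good x y \<longleftrightarrow> (x - t)\<^sup>2 + y\<^sup>2 \<in> I \<and> (x + t)\<^sup>2 + y\<^sup>2 \<in> I"

lemma S_uminus: "S (- x) y = - S x y"
  by (simp add: S_def power2_eq_square algebra_simps)

lemma good_uminus: "good (- x) y \<longleftrightarrow> good x y"
  by (auto simp: good_def power2_eq_square algebra_simps)

lemma S_zero: "S 0 y = 0"
  by (simp add: S_def)

lemma S_pos: "good x y \<Longrightarrow> 0 < x \<Longrightarrow> 0 < S x y"
proof -
  assume g: "good x y" and x: "0 < x"
  have "(x + t)\<^sup>2 - (x - t)\<^sup>2 = 4 * (x * t)" by (simp add: power2_eq_square algebra_simps)
  then have "(x - t)\<^sup>2 < (x + t)\<^sup>2" using mult_pos_pos[OF x t] by linarith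
  then show ?thesis using anti g unfolding good_def S_def by (auto simp: monotone_on_def)
qed

text \<open>\<open>S x y\<close> is the drop of \<psi> over an interval of length 4 x t, a length
  independent of y. Increasing y^2 moves the interval to the right, where a decreasing convex
  function drops less.\<close>

lemma S_mono:
  assumes g: "good x y" "good x y'" and x: "0 \<le> x" and y: "y\<^sup>2 \<le> y'\<^sup>2"
  shows "S x y' \<le> S x y"
proof -
  have e: "(x - t)\<^sup>2 + z\<^sup>2 + 4 * (x * t) = (x + t)\<^sup>2 + z\<^sup>2" for z
    by (simp add: power2_eq_square algebra_simps)
  show ?thesis
    using convex_on_increments_mono[OF conv, of "(x - t)\<^sup>2 + y\<^sup>2" "(x - t)\<^sup>2 + y'\<^sup>2" "4 * (x * t)"]
      g x y t unfolding e by (simp add: S_def good_def)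
qed

definition seg_good :: "real \<Rightarrow> real \<Rightarrow> real \<Rightarrow> real \<Rightarrow> bool" where
  "seg_good p1 p2 q1 q2 \<longleftrightarrow> (\<forall>l\<in>{0..1}. good (p1 + l * (q1 - p1)) (p2 + l * (q2 - p2)))"

text \<open>The integral is normalised to the unit parameter interval: the integral of
  \<open>S\<close> dy along the segment is \<open>(q2 - p2) * D p1 p2 q1 q2\<close>. In this form
  horizontal edges need no separate treatment, as their factor is 0.\<close>

definition D :: "real \<Rightarrow> real \<Rightarrow> real \<Rightarrow> real \<Rightarrow> real" where
  "D p1 p2 q1 q2 = integral {0..1} (\<lambda>l. S (p1 + l * (q1 - p1)) (p2 + l * (q2 - p2)))"

lemma continuous_D:
  assumes "seg_good p1 p2 q1 q2"
  shows "continuous_on {0..1} (\<lambda>l. S (p1 + l * (q1 - p1)) (p2 + l * (q2 - p2)))"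
  unfolding S_def using assms
  by (intro continuous_on_diff continuous_on_compose2[OF cont] continuous_intros)
     (auto simp: seg_good_def good_def)

lemma seg_good_rev:
  assumes "seg_good p1 p2 q1 q2"
  shows "seg_good q1 q2 p1 p2"
  unfolding seg_good_def
proof
  fix l :: real assume "l \<in> {0..1}"
  then have "1 - l \<in> {0..1}" by auto
  then have "good (p1 + (1 - l) * (q1 - p1)) (p2 + (1 - l) * (q2 - p2))"
    using assms by (simp only: seg_good_def)
  then show "good (q1 + l * (p1 - q1)) (q2 + l * (p2 - q2))" by (simp add: algebra_simps)
qed

lemma D_rev:
  assumes "seg_good p1 p2 q1 q2"
  shows "D q1 q2 p1 p2 = D p1 p2 q1 q2"
proof -
  have e: "q1 + l * (p1 - q1) = p1 + (0 + 1 - l) * (q1 - p1)" "q2 + l * (p2 - q2) = p2 + (0 + 1 - l) * (q2 - p2)" for l :: real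
    by (simp_all add: algebra_simps)
  show ?thesis
    unfolding D_def e
    by (rule integral_reflect_interval[where f = "\<lambda>l. S (p1 + l * (q1 - p1)) (p2 + l * (q2 - p2))"])
       (auto intro: continuous_D assms)
qed

text \<open>The condition \<open>cross\<close> compares heights. If the segment has height h at
  abscissa x > 0 and h' at -x, then (h^2 - h'^2) (q1 - p1)^2 equals -4 x times the left side of
  \<open>cross\<close>. So the right point of each pair is at least as far from the axis, and its
  positive \<open>S\<close> is at most what the left point takes away. With the midpoint at a
  nonpositive abscissa, every point on the right has a partner.\<close>

lemma D_nonpos:
  assumes g: "seg_good p1 p2 q1 q2" and le: "p1 \<le> q1" and mid: "p1 + q1 \<le> 0"
    and cross: "(q2 - p2) * (p1 * q2 - q1 * p2) \<le> 0"
  shows "D p1 p2 q1 q2 \<le> 0" "p1 + q1 < 0 \<Longrightarrow> D p1 p2 q1 q2 < 0"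
proof -
  let ?d = "q1 - p1" and ?e = "q2 - p2"
  let ?f = "\<lambda>l. S (p1 + l * ?d) (p2 + l * ?e)"
  have good: "good (p1 + l * ?d) (p2 + l * ?e)" if "l \<in> {0..1}" for l
    using g that by (simp add: seg_good_def)
  have neg: "?f l < 0" if "l \<in> {0..1}" "p1 + l * ?d < 0" for l
    using S_pos[of "- (p1 + l * ?d)" "p2 + l * ?e"] good[OF that(1)] that(2)
    unfolding good_uminus S_uminus by simp
  have zero: "?f l = 0" if "p1 + l * ?d = 0" for l
    unfolding that by (rule S_zero)
  have pair: "?f l + ?f m \<le> 0" if l: "l \<in> {0..1}" and m: "m \<in> {0..1}" and pos: "p1 + l * ?d \<ge> 0"
    and sum: "(p1 + l * ?d) + (p1 + m * ?d) = 0" for l m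
  proof (cases "p1 + l * ?d = 0")
    case True
    then show ?thesis using zero[of l] zero[of m] sum by simp
  next
    case False
    define x where "x = p1 + l * ?d"
    define h where "h = p2 + l * ?e"
    define h' where "h' = p2 + m * ?e"
    have x: "x > 0" "p1 + m * ?d = - x" using False pos sum by (auto simp: x_def)
    have lm: "(l - m) * ?d = 2 * x" using sum by (simp add: x_def algebra_simps)
    have "?d \<noteq> 0" using lm x by auto
    then have dpos: "?d > 0" using le by simp
    have "(h + h') * ?d = - 2 * (p1 * ?e - p2 * ?d) + (2 * p1 + (l + m) * ?d) * ?e"
      by (simp add: h_def h'_def algebra_simps)
    also have "2 * p1 + (l + m) * ?d = 0" using sum by (simp add: algebra_simps)
    finally have hs: "(h + h') * ?d = - 2 * (p1 * q2 - q1 * p2)" by (simp add: algebra_simps)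
    have "h - h' = (l - m) * ?e" by (simp add: h_def h'_def algebra_simps)
    then have hd: "(h - h') * ?d = 2 * x * ?e" using lm by (metis mult.commute mult.assoc)
    have "(h\<^sup>2 - h'\<^sup>2) * (?d * ?d) = ((h - h') * ?d) * ((h + h') * ?d)"
      by (simp add: power2_eq_square algebra_simps)
    also have "\<dots> = (4 * x) * (- (?e * (p1 * q2 - q1 * p2)))"
      unfolding hs hd by (simp add: algebra_simps)
    also have "\<dots> \<ge> 0" using x cross by (intro mult_nonneg_nonneg) auto
    finally have "h'\<^sup>2 \<le> h\<^sup>2" using mult_pos_pos[OF dpos dpos] by (simp only: zero_le_mult_iff) linarith
    moreover have "good x h" "good x h'"
      using good[OF l] good[OF m] x(2) good_uminus[of x h'] by (auto simp: x_def h_def h'_def)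
    ultimately have "S x h \<le> S x h'" using x by (intro S_mono) auto
    moreover have "?f m = - S x h'" unfolding x(2) h'_def S_uminus ..
    ultimately show ?thesis by (simp add: x_def h_def)
  qed
  have mid': "2 * p1 + ?d \<le> 0" and d0: "0 \<le> ?d" using mid le by auto
  note N = integral_nonpos_pairing[OF continuous_D[OF g] d0 mid' neg _ pair]
  show "D p1 p2 q1 q2 \<le> 0" unfolding D_def by (rule N(1)) (use zero in auto)
  show "D p1 p2 q1 q2 < 0" if "p1 + q1 < 0" unfolding D_def by (rule N(2)) (use zero that in auto)
qed

text \<open>\<open>S\<close> is odd in x. The mirror image of the segment in the vertical line x =
  0, traversed backwards so that abscissae still increase, satisfies the hypotheses of
  \<open>D_nonpos\<close>, and its integral is the negative of the given one.\<close>

lemma D_nonneg: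
  assumes g: "seg_good p1 p2 q1 q2" and le: "p1 \<le> q1" and mid: "0 \<le> p1 + q1"
    and cross: "0 \<le> (q2 - p2) * (p1 * q2 - q1 * p2)"
  shows "0 \<le> D p1 p2 q1 q2" "0 < p1 + q1 \<Longrightarrow> 0 < D p1 p2 q1 q2"
proof -
  have e: "- q1 + l * (- p1 - - q1) = - (q1 + l * (p1 - q1))" for l by (simp add: algebra_simps)
  have g': "seg_good (- q1) q2 (- p1) p2"
    using seg_good_rev[OF g] unfolding seg_good_def e good_uminus .
  have "D (- q1) q2 (- p1) p2 = - D q1 q2 p1 p2"
    unfolding D_def e S_uminus by simp
  then have "D (- q1) q2 (- p1) p2 = - D p1 p2 q1 q2" using D_rev[OF g] by simp
  moreover have "(p2 - q2) * (- q1 * p2 - - p1 * q2) \<le> 0" using cross by (simp add: algebra_simps)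
  ultimately show "0 \<le> D p1 p2 q1 q2" "0 < p1 + q1 \<Longrightarrow> 0 < D p1 p2 q1 q2"
    using D_nonpos[OF g'] le mid by auto
qed

lemma seg_good_sub:
  assumes g: "seg_good p1 p2 q1 q2" and s: "s \<in> {0..1}"
  shows "seg_good p1 p2 (p1 + s * (q1 - p1)) (p2 + s * (q2 - p2))"
    and "seg_good (p1 + s * (q1 - p1)) (p2 + s * (q2 - p2)) q1 q2"
proof -
  show "seg_good p1 p2 (p1 + s * (q1 - p1)) (p2 + s * (q2 - p2))"
    unfolding seg_good_def
  proof
    fix l :: real assume "l \<in> {0..1}"
    then have "l * s \<in> {0..1}" using s by (auto intro: mult_le_one)
    then have "good (p1 + l * s * (q1 - p1)) (p2 + l * s * (q2 - p2))" using g by (simp only: seg_good_def)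
    then show "good (p1 + l * (p1 + s * (q1 - p1) - p1)) (p2 + l * (p2 + s * (q2 - p2) - p2))"
      by (simp add: mult.assoc)
  qed
  show "seg_good (p1 + s * (q1 - p1)) (p2 + s * (q2 - p2)) q1 q2"
    unfolding seg_good_def
  proof
    fix l :: real assume "l \<in> {0..1}"
    then have "s + l * (1 - s) \<in> {0..1}" using s mult_right_mono[of l 1 "1 - s"] by auto
    then have "good (p1 + (s + l * (1 - s)) * (q1 - p1)) (p2 + (s + l * (1 - s)) * (q2 - p2))"
      using g by (simp only: seg_good_def)
    then show "good (p1 + s * (q1 - p1) + l * (q1 - (p1 + s * (q1 - p1)))) (p2 + s * (q2 - p2) + l * (q2 - (p2 + s * (q2 - p2))))"
      by (simp add: algebra_simps)
  qed
qed

lemma D_split: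
  assumes g: "seg_good p1 p2 q1 q2" and s: "s \<in> {0..1}"
    and r: "r1 = p1 + s * (q1 - p1)" "r2 = p2 + s * (q2 - p2)"
  shows "(q2 - p2) * D p1 p2 q1 q2 = (r2 - p2) * D p1 p2 r1 r2 + (q2 - r2) * D r1 r2 q1 q2"
proof -
  let ?f = "\<lambda>l. S (p1 + l * (q1 - p1)) (p2 + l * (q2 - p2))"
  have c: "continuous_on {0..1} ?f" by (rule continuous_D[OF g])
  have c1: "continuous_on {0..s} ?f" "continuous_on {s..1} ?f"
    using s by (auto intro: continuous_on_subset[OF c])
  have "D p1 p2 q1 q2 = integral {0..s} ?f + integral {s..1} ?f"
    unfolding D_def using s
    by (intro Henstock_Kurzweil_Integration.integral_combine[symmetric] integrable_continuous_interval c) auto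
  also have "integral {0..s} ?f = (s - 0) * integral {0..1} (\<lambda>x. ?f (0 + x * (s - 0)))"
    using integral_unit_interval_affine[OF _ c1(1)] s by simp
  also have "integral {0..1} (\<lambda>x. ?f (0 + x * (s - 0))) = D p1 p2 r1 r2"
    unfolding D_def r by (simp add: algebra_simps)
  also have "integral {s..1} ?f = (1 - s) * integral {0..1} (\<lambda>x. ?f (s + x * (1 - s)))"
    using integral_unit_interval_affine[OF _ c1(2)] s by simp
  also have "integral {0..1} (\<lambda>x. ?f (s + x * (1 - s))) = D r1 r2 q1 q2"
  proof -
    have "p1 + (s + x * (1 - s)) * (q1 - p1) = r1 + x * (q1 - r1)"
      "p2 + (s + x * (1 - s)) * (q2 - p2) = r2 + x * (q2 - r2)" for x
      by (simp_all add: r algebra_simps)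
    then show ?thesis by (simp add: D_def)
  qed
  finally have "D p1 p2 q1 q2 = (s - 0) * D p1 p2 r1 r2 + (1 - s) * D r1 r2 q1 q2" .
  moreover have "r2 - p2 = (q2 - p2) * s" "q2 - r2 = (q2 - p2) * (1 - s)"
    by (simp_all add: r(2) algebra_simps)
  ultimately show ?thesis by (simp add: distrib_left)
qed

text \<open>This is the comparison of the two derivatives, with the origin at the midpoint of the
  centers and (a, b, c) its barycentric coordinates. B lies to the left of CA. The edge CA always
  contributes with the favourable sign, and so does BC; only the sign for BA is open, and it decides
  between the two cases at the end.\<close>

lemma triangle_edges_ineq:
  assumes ya: "yc \<le> yb" "yb \<le> ya" "yc < ya"
    and area: "(xa - xc) * (yb - yc) - (xb - xc) * (ya - yc) > 0"
    and angle: "0 \<le> (xa - xb) * (xc - xb) + (ya - yb) * (yc - yb)"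
    and bary: "a \<le> 1/2" "b \<le> 1/2" "c \<le> 1/2" "a + b + c = 1"
      "a * xa + b * xb + c * xc = 0" "a * ya + b * yb + c * yc = 0"
    and xc: "xc \<le> xa"
    and good: "seg_good xc yc xb yb" "seg_good xb yb xa ya" "seg_good xc yc xa ya"
  shows "(yb - yc) * D xc yc xb yb + (ya - yb) * D xb yb xa ya < (ya - yc) * D xc yc xa ya"
proof -
  define X where "X = (xa - xc) * (yb - yc) - (xb - xc) * (ya - yc)"
  have Xpos: "X > 0" using area by (simp add: X_def)
  have X2: "X = (xa - xb) * (yb - yc) + (xc - xb) * (ya - yb)" by (simp add: X_def algebra_simps)
  have nn: "a \<ge> 0" "b \<ge> 0" "c \<ge> 0" using bary by auto
  \<comment> \<open>These determinants are twice the signed areas of the triangles spanned by the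
    origin and an edge, hence the barycentric coordinates scaled by \<open>X\<close>. Their signs
    will supply the cross conditions for the three edges.\<close>
  have ca: "xc * ya - xa * yc = b * X" and ab: "xa * yb - xb * ya = c * X" and bc: "xb * yc - xc * yb = a * X"
  proof -
    have c: "c = 1 - a - b" using bary(4) by simp
    have x: "xc = - a * (xa - xc) - b * (xb - xc)" and y: "yc = - a * (ya - yc) - b * (yb - yc)"
      using bary(5,6) by (auto simp: c algebra_simps)
    have "xc * (ya - yc) - (xa - xc) * yc = b * X"
      by (subst (1) x, subst (2) y) (simp add: X_def algebra_simps)
    then show "xc * ya - xa * yc = b * X" by (simp add: algebra_simps)
    have "(xb - xc) * yc - xc * (yb - yc) = a * X"
      by (subst (2) x, subst (1) y) (simp add: X_def algebra_simps)
    then show bc: "xb * yc - xc * yb = a * X" by (simp add: algebra_simps)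
    have "(xa * yb - xb * ya) + (xb * yc - xc * yb) + (xc * ya - xa * yc) = X"
      by (simp add: X_def algebra_simps)
    then have "(xa * yb - xb * ya) + a * X + b * X = (a + b + c) * X"
      using bc \<open>xc * ya - xa * yc = b * X\<close> bary(4) by simp
    then show "xa * yb - xb * ya = c * X" by (simp add: algebra_simps)
  qed
  \<comment> \<open>B is at intermediate height, so a non-obtuse angle at B forces A and C onto the
    same side of the vertical line through B; the orientation \<open>X > 0\<close> says that it is
    the right side. The strict versions are needed when the midpoint of CA has abscissa 0.\<close>
  have left: "xb \<le> xa" "xb \<le> xc" "yb < ya \<Longrightarrow> xb < xc" "yc < yb \<Longrightarrow> xb < xa"
  proof -
    consider "yc < yb" "yb < ya" | "yc = yb" "yb < ya" | "yc < yb" "yb = ya" using ya by linarith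
    then have "xb \<le> xa \<and> xb \<le> xc \<and> (yb < ya \<longrightarrow> xb < xc) \<and> (yc < yb \<longrightarrow> xb < xa)"
    proof cases
      case 1
      then have "(ya - yb) * (yb - yc) > 0" by simp
      then have "(xa - xb) * (xc - xb) > 0" using angle by (simp add: algebra_simps)
      then consider "xa > xb" "xc > xb" | "xa < xb" "xc < xb" by (auto simp: zero_less_mult_iff)
      then show ?thesis
      proof cases
        case 2
        then have "(xa - xb) * (yb - yc) < 0" "(xc - xb) * (ya - yb) < 0"
          using 1 by (auto intro: mult_neg_pos)
        then show ?thesis using Xpos X2 by simp
      qed auto
    next
      case 2
      then have "xc > xb" using Xpos X2 by (simp add: zero_less_mult_iff)
      then show ?thesis using angle 2 by (auto simp: zero_le_mult_iff)
    next
      case 3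
      then have "xa > xb" using Xpos X2 by (simp add: zero_less_mult_iff)
      then show ?thesis using angle 3 by (auto simp: zero_le_mult_iff)
    qed
    then show "xb \<le> xa" "xb \<le> xc" "yb < ya \<Longrightarrow> xb < xc" "yc < yb \<Longrightarrow> xb < xa" by auto
  qed
  text \<open>The origin is a convex combination of the edge midpoints with weights \<open>1 - 2a\<close>, \<open>1 - 2b\<close>, \<open>1 - 2c\<close>.\<close>
  have mids: "(1 - 2 * a) * (xb + xc) + (1 - 2 * b) * (xa + xc) + (1 - 2 * c) * (xa + xb) = 0"
  proof -
    have "(1 - 2 * a) * (xb + xc) + (1 - 2 * b) * (xa + xc) + (1 - 2 * c) * (xa + xb)
      = 2 * (a * xa + b * xb + c * xc) + 2 * (1 - (a + b + c)) * (xa + xb + xc)"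
      by (simp add: algebra_simps)
    then show ?thesis using bary by simp
  qed
  have w: "(1 - 2 * a) + (1 - 2 * b) + (1 - 2 * c) = 1" using bary by simp
  \<comment> \<open>Among the three doubled midpoint abscissae \<open>xa + xc\<close> is the largest
    and, by \<open>xc \<le> xa\<close>, \<open>xb + xc\<close> is the smallest; their weighted mean
    is 0.\<close>
  have mid_ca: "0 \<le> xa + xc"
  proof -
    have "0 \<le> (1 - 2 * a) * (xa + xc) + (1 - 2 * b) * (xa + xc) + (1 - 2 * c) * (xa + xc)"
      unfolding mids[symmetric] using left bary by (intro add_mono mult_left_mono) auto
    also have "\<dots> = ((1 - 2 * a) + (1 - 2 * b) + (1 - 2 * c)) * (xa + xc)" by (simp only: distrib_right)
    finally show ?thesis unfolding w by simp
  qed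
  have mid_bc: "xb + xc \<le> 0"
  proof -
    have "((1 - 2 * a) + (1 - 2 * b) + (1 - 2 * c)) * (xb + xc)
      = (1 - 2 * a) * (xb + xc) + (1 - 2 * b) * (xb + xc) + (1 - 2 * c) * (xb + xc)" by (simp only: distrib_right)
    also have "\<dots> \<le> 0"
    proof -
      have "(1 - 2 * b) * (xb + xc) \<le> (1 - 2 * b) * (xa + xc)" "(1 - 2 * c) * (xb + xc) \<le> (1 - 2 * c) * (xa + xb)"
        using left bary xc by (auto intro!: mult_left_mono)
      then show ?thesis using mids by linarith
    qed
    finally show ?thesis unfolding w by simp
  qed
  \<comment> \<open>Edges enter the claim with increasing height, whereas the sign lemmas want
    increasing abscissa. For BC these orientations may differ, so the edge is reversed.\<close>
  have goodB: "seg_good xb yb xc yc" using seg_good_rev[OF good(1)] .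
  have Dcb: "D xc yc xb yb = D xb yb xc yc" using D_rev[OF goodB] .
  have cross_bc: "(yc - yb) * (xb * yc - xc * yb) \<le> 0"
    unfolding bc using ya nn Xpos by (intro mult_nonpos_nonneg) auto
  have cross_ba: "(ya - yb) * (xb * ya - xa * yb) \<le> 0"
  proof -
    have e: "xb * ya - xa * yb = - (c * X)" using ab by simp
    show ?thesis unfolding e using ya nn Xpos by (intro mult_nonneg_nonpos) auto
  qed
  have cross_ca: "0 \<le> (ya - yc) * (xc * ya - xa * yc)"
    unfolding ca using ya nn Xpos by (intro mult_nonneg_nonneg) auto
  note Dbc = D_nonpos[OF goodB left(2) mid_bc cross_bc]
  have bc_le: "(yb - yc) * D xc yc xb yb \<le> 0"
    unfolding Dcb using Dbc(1) ya by (intro mult_nonneg_nonpos) auto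
  have mid_ca': "0 \<le> xc + xa" using mid_ca by simp
  note Dca = D_nonneg[OF good(3) xc mid_ca' cross_ca]
  show ?thesis
  proof (cases "xa + xb \<le> 0")
    case True
    then have mid_ba: "xb + xa \<le> 0" by simp
    note Dba = D_nonpos[OF good(2) left(1) mid_ba cross_ba]
    have ba_le: "(ya - yb) * D xb yb xa ya \<le> 0"
      using Dba(1) ya by (intro mult_nonneg_nonpos) auto
    have ca_ge: "0 \<le> (ya - yc) * D xc yc xa ya"
      using Dca(1) ya by (intro mult_nonneg_nonneg) auto
    \<comment> \<open>Strictness: if CA has its midpoint at abscissa 0, then one of the two left
      edges is not horizontal and has its midpoint strictly to the left.\<close>
    consider "0 < xc + xa" | "xc + xa = 0" "yb < ya" | "xc + xa = 0" "yb = ya" "yc < yb"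
      using mid_ca ya by linarith
    then show ?thesis
    proof cases
      case 1
      then have "0 < (ya - yc) * D xc yc xa ya" using Dca(2) ya by simp
      then show ?thesis using ba_le bc_le by linarith
    next
      case 2
      then have "xb + xa < 0" using left(3) by simp
      then have "(ya - yb) * D xb yb xa ya < 0" using Dba(2) 2 by (intro mult_pos_neg) auto
      then show ?thesis using ca_ge bc_le by linarith
    next
      case 3
      then have "xb + xc < 0" using left(4) by simp
      then have "(yb - yc) * D xc yc xb yb < 0" unfolding Dcb using Dbc(2) 3 by (intro mult_pos_neg) auto
      then show ?thesis using ca_ge ba_le by linarith
    qed
  next
    case False
    text \<open>Only the edge from \<open>B\<close> to \<open>A\<close> has its midpoint on the wrong side. Beyond abscissa
      \<open>- xb\<close> it is dominated pointwise by the edge from \<open>C\<close> to \<open>A\<close>, which there is steeper and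
      closer to the axis.\<close>
    define m where "m = - xb"
    have m: "xb \<le> m" "xc \<le> m" "m < xa" "0 \<le> m" using False mid_bc left by (auto simp: m_def)
    \<comment> \<open>The vertical line at abscissa \<open>m\<close> cuts BA in R = (m, hR) and CA
      in T = (m, hT). The piece from B to R spans [xb, -xb], so its midpoint has abscissa exactly 0
      and the sign lemma just applies. The numbers \<kappa>1 and \<kappa>2 are the slopes of BA and
      CA.\<close>
    define \<sigma> where "\<sigma> = (m - xb) / (xa - xb)"
    define \<sigma>' where "\<sigma>' = (m - xc) / (xa - xc)"
    have s: "\<sigma> \<in> {0..1}" "\<sigma>' \<in> {0..1}" using m by (auto simp: \<sigma>_def \<sigma>'_def)
    define hR where "hR = yb + \<sigma> * (ya - yb)"
    define hT where "hT = yc + \<sigma>' * (ya - yc)"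
    have mR: "m = xb + \<sigma> * (xa - xb)" and mT: "m = xc + \<sigma>' * (xa - xc)"
      using m by (auto simp: \<sigma>_def \<sigma>'_def)
    define \<kappa>1 where "\<kappa>1 = (ya - yb) / (xa - xb)"
    define \<kappa>2 where "\<kappa>2 = (ya - yc) / (xa - xc)"
    have k1: "ya - yb = \<kappa>1 * (xa - xb)" "0 \<le> \<kappa>1" and k2: "ya - yc = \<kappa>2 * (xa - xc)"
      using m ya by (auto simp: \<kappa>1_def \<kappa>2_def)
    have hR: "hR = ya - (xa - m) * \<kappa>1"
    proof -
      have "hR = ya - (1 - \<sigma>) * (ya - yb)" by (simp add: hR_def algebra_simps)
      also have "\<dots> = ya - ((1 - \<sigma>) * (xa - xb)) * \<kappa>1" unfolding k1(1) by (simp add: algebra_simps)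
      also have "(1 - \<sigma>) * (xa - xb) = xa - m" by (subst mR) (simp add: algebra_simps)
      finally show ?thesis .
    qed
    have hT: "hT = ya - (xa - m) * \<kappa>2"
    proof -
      have "hT = ya - (1 - \<sigma>') * (ya - yc)" by (simp add: hT_def algebra_simps)
      also have "\<dots> = ya - ((1 - \<sigma>') * (xa - xc)) * \<kappa>2" unfolding k2 by (simp add: algebra_simps)
      also have "(1 - \<sigma>') * (xa - xc) = xa - m" by (subst mT) (simp add: algebra_simps)
      finally show ?thesis .
    qed
    have "X = (ya - yc) * (xa - xb) - (ya - yb) * (xa - xc)" by (simp add: X_def algebra_simps)
    then have "X = (\<kappa>2 - \<kappa>1) * ((xa - xc) * (xa - xb))" unfolding k1(1) k2 by (simp add: algebra_simps)
    moreover have "(xa - xc) * (xa - xb) > 0" using m by simp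
    ultimately have kk: "\<kappa>1 < \<kappa>2" using Xpos zero_less_mult_pos2 by fastforce
    then have TR: "hT < hR" using m by (simp add: hR hT)
    \<comment> \<open>Here \<open>b \<le> 1/2\<close> enters. The point opposite to B through the
      origin has B-coordinate 2 b - 1, so it is not on the side of the line CA where B lies. It has
      the abscissa \<open>m\<close> of T and height \<open>- yb\<close>, hence it is not above T.
      Together with \<open>yb \<le> hR\<close> and \<open>hT < hR\<close> this places T no farther
      from the axis than R.\<close>
    have "0 \<le> hT + yb"
    proof -
      have "hT * (xa - xc) = yc * (xa - xc) + (\<sigma>' * (xa - xc)) * (ya - yc)" by (simp add: hT_def algebra_simps)
      also have "\<sigma>' * (xa - xc) = m - xc" using mT by simp
      finally have "(hT + yb) * (xa - xc) = X - 2 * (xc * ya - xa * yc)"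
        by (simp add: X_def m_def algebra_simps)
      also have "\<dots> = (1 - 2 * b) * X" unfolding ca by (simp add: algebra_simps)
      also have "\<dots> \<ge> 0" using bary Xpos by simp
      finally show ?thesis using m by (simp add: zero_le_mult_iff)
    qed
    moreover have "yb \<le> hR" using s ya by (simp add: hR_def)
    ultimately have RT: "0 \<le> hT + hR" by simp
    have hRa: "hR \<le> ya" using hR m k1(2) by simp
    then have ya0: "0 \<le> ya" using RT TR by simp
    have gBR: "seg_good xb yb m hR" and gRA: "seg_good m hR xa ya"
      using seg_good_sub[OF good(2) s(1)] unfolding hR_def[symmetric] mR[symmetric] by auto
    have gCT: "seg_good xc yc m hT" and gTA: "seg_good m hT xa ya"
      using seg_good_sub[OF good(3) s(2)] unfolding hT_def[symmetric] mT[symmetric] by auto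
    have "D xb yb m hR \<le> 0"
    proof (rule D_nonpos(1)[OF gBR m(1)])
      have "hR - yb = \<sigma> * (ya - yb)" "xb * hR - m * yb = \<sigma> * (xb * ya - xa * yb)"
        by (auto simp: hR_def mR algebra_simps)
      then have "(hR - yb) * (xb * hR - m * yb) = (\<sigma> * \<sigma>) * ((ya - yb) * (xb * ya - xa * yb))" by simp
      then show "(hR - yb) * (xb * hR - m * yb) \<le> 0" using cross_ba by (simp add: mult_nonneg_nonpos)
    qed (simp add: m_def)
    then have eBR: "(hR - yb) * D xb yb m hR \<le> 0" using \<open>yb \<le> hR\<close> by (intro mult_nonneg_nonpos) auto
    have "0 \<le> D xc yc m hT"
    proof (rule D_nonneg(1)[OF gCT m(2)])
      have "hT - yc = \<sigma>' * (ya - yc)" "xc * hT - m * yc = \<sigma>' * (xc * ya - xa * yc)"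
        by (auto simp: hT_def mT algebra_simps)
      then have "(hT - yc) * (xc * hT - m * yc) = (\<sigma>' * \<sigma>') * ((ya - yc) * (xc * ya - xa * yc))" by simp
      then show "0 \<le> (hT - yc) * (xc * hT - m * yc)" using cross_ca by simp
      show "0 \<le> xc + m" using left(2) by (simp add: m_def)
    qed
    moreover have "yc \<le> hT" using s ya by (simp add: hT_def)
    ultimately have eCT: "0 \<le> (hT - yc) * D xc yc m hT" by simp
    have "D m hR xa ya \<le> D m hT xa ya"
      unfolding D_def
    proof (intro integral_le integrable_continuous_interval continuous_D gRA gTA)
      fix l :: real assume l: "l \<in> {0..1}"
      show "S (m + l * (xa - m)) (hR + l * (ya - hR)) \<le> S (m + l * (xa - m)) (hT + l * (ya - hT))"
      proof (rule S_mono)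
        show "good (m + l * (xa - m)) (hT + l * (ya - hT))" "good (m + l * (xa - m)) (hR + l * (ya - hR))"
          using gTA gRA l by (auto simp: seg_good_def)
        show "0 \<le> m + l * (xa - m)" using l m by simp
        have e: "hT + l * (ya - hT) = (1 - l) * hT + l * ya" "hR + l * (ya - hR) = (1 - l) * hR + l * ya"
          by (auto simp: algebra_simps)
        have "(1 - l) * hT \<le> (1 - l) * hR" using l TR by (simp add: mult_left_mono)
        moreover have "0 \<le> (1 - l) * hT + (1 - l) * hR" "0 \<le> l * ya"
          using l RT ya0 unfolding distrib_left[symmetric] by auto
        ultimately have "\<bar>hT + l * (ya - hT)\<bar> \<le> \<bar>hR + l * (ya - hR)\<bar>"
          unfolding e by arith
        then show "(hT + l * (ya - hT))\<^sup>2 \<le> (hR + l * (ya - hR))\<^sup>2" by (simp add: abs_le_square_iff)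
      qed
    qed
    moreover have "0 < D m hT xa ya"
    proof -
      have "integral {0..1::real} (\<lambda>_. 0) < D m hT xa ya"
        unfolding D_def
      proof (rule integral_less_real[OF _ continuous_D[OF gTA]])
        fix l :: real assume l: "l \<in> {0<..<1}"
        show "0 < S (m + l * (xa - m)) (hT + l * (ya - hT))"
        proof (rule S_pos)
          show "good (m + l * (xa - m)) (hT + l * (ya - hT))" using gTA l by (auto simp: seg_good_def)
          have "0 < l * (xa - m)" using l m by simp
          then show "0 < m + l * (xa - m)" using m(4) by (rule add_nonneg_pos[rotated])
        qed
      qed auto
      then show ?thesis by simp
    qed
    \<comment> \<open>Over the common range of abscissae from \<open>m\<close> to \<open>xa\<close>
      one has dy = \<kappa> dx on each edge. The strictly larger slope of CA, multiplied by a
      strictly positive integral, gives the strict inequality.\<close>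
    ultimately have "\<kappa>1 * D m hR xa ya < \<kappa>2 * D m hT xa ya"
      using kk k1(2) by (meson mult_left_mono mult_strict_right_mono order_le_less_trans)
    then have "(xa - m) * (\<kappa>1 * D m hR xa ya) < (xa - m) * (\<kappa>2 * D m hT xa ya)"
      using m by simp
    then have "(ya - hR) * D m hR xa ya < (ya - hT) * D m hT xa ya"
      by (simp add: hR hT mult.assoc)
    moreover have "(ya - yb) * D xb yb xa ya = (hR - yb) * D xb yb m hR + (ya - hR) * D m hR xa ya"
      by (rule D_split[OF good(2) s(1) mR hR_def])
    moreover have "(ya - yc) * D xc yc xa ya = (hT - yc) * D xc yc m hT + (ya - hT) * D m hT xa ya"
      by (rule D_split[OF good(3) s(2) mT hT_def])
    ultimately show ?thesis using eBR eCT bc_le by linarith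
  qed
qed

end

section \<open>Derivative of the potential along a line\<close>

context singular_kernel
begin

lemma integrable_shifted:
  assumes "bounded T" and [measurable]: "T \<in> sets borel"
  shows "integrable lborel (\<lambda>z :: real \<times> real. indicator T z * k (norm (z - w)))"
proof -
  obtain R where R: "\<And>z. z \<in> T \<Longrightarrow> dist w z \<le> R" using assms(1) unfolding bounded_any_center[where a = w] by auto
  have "integrable lborel (\<lambda>y. indicator (cball 0 R) (-w + y) * k (norm (-w + y)))"
    using integrable_near_0_prod[of R]
    by (intro integrable_distr[of "(+) (-w)" lborel borel]) (simp_all add: lborel_distr_plus)
  then show ?thesis
    by (rule Bochner_Integration.integrable_bound)
       (use R assms in \<open>auto simp: indicator_def dist_norm norm_minus_commute\<close>)
qed

lemma slice_antiderivative:
  assumes "s \<noteq> 0"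
  obtains N where "\<And>x. (N has_real_derivative k (norm (x, s))) (at x)"
proof -
  have "isCont (\<lambda>x :: real. k (norm (x, s))) x" for x
  proof -
    have "continuous_on UNIV (\<lambda>x :: real. k (norm (x, s)))"
      using assms by (intro continuous_on_compose2[OF cont] continuous_intros) (auto simp: zero_prod_def)
    then show ?thesis by (simp add: continuous_on_eq_continuous_at)
  qed
  then have "\<exists>F. \<forall>x::real. -\<infinity> < ereal x \<longrightarrow> ereal x < \<infinity> \<longrightarrow> (F has_vector_derivative k (norm (x, s))) (at x)"
    by (intro einterval_antiderivative) auto
  then show ?thesis using that by (auto simp: has_real_derivative_iff_has_vector_derivative)
qed

text \<open>On the chord at height s, the integral is N (fR s - t) - N (fL s - t) for an
  antiderivative N of the kernel along that horizontal line. Its t-derivative is the kernel at the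
  left end minus the kernel at the right end, and the kernel itself is never differentiated. Since N
  is Lipschitz with constant W s, twice W dominates all difference quotients.\<close>

lemma potential_has_derivative:
  fixes T :: "(real \<times> real) set" and fL fR :: "real \<Rightarrow> real"
  assumes bdd: "bounded T" and [measurable]: "T \<in> sets borel" "fL \<in> borel_measurable borel" "fR \<in> borel_measurable borel"
    and slice: "AE s in lborel. (\<forall>u. (u, s) \<in> T \<longleftrightarrow> y0 < s \<and> s < y1 \<and> fL s \<le> u \<and> u \<le> fR s) \<and>
      (y0 < s \<and> s < y1 \<longrightarrow> fL s \<le> fR s)"
  shows "((\<lambda>t. LINT z|lborel. indicator T z * k (norm (z - (t, 0)))) has_real_derivative
    (LINT s|lborel. indicator {y0<..<y1} s * (k (norm (fL s - t, s)) - k (norm (fR s - t, s))))) (at t)"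
proof -
  define I where "I t s = (LINT u|lborel. indicator T (u, s) * k (norm (u - t, s)))" for t s
  define j where "j s = indicator {y0<..<y1} s * (k (norm (fL s - t, s)) - k (norm (fR s - t, s)))" for s
  have int2: "integrable (lborel \<Otimes>\<^sub>M lborel) (\<lambda>(u :: real, s :: real). indicator T (u, s) * k (norm (u - t, s)))" for t
    using integrable_shifted[OF bdd \<open>T \<in> sets borel\<close>, of "(t, 0)"]
    by (simp add: lborel_prod case_prod_beta' minus_prod_def)
  have intI: "integrable lborel (I t)" for t
    unfolding I_def by (rule lborel_pair.integrable_snd[OF int2])
  have phi: "(LINT z|lborel. indicator T z * k (norm (z - (t, 0)))) = (LINT s|lborel. I t s)" for t
    using lborel_pair.integral_snd[OF int2, of t] unfolding I_def
    by (simp add: lborel_prod case_prod_beta' minus_prod_def)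
  have "((\<lambda>t. LINT s|lborel. I t s) has_real_derivative (LINT s|lborel. j s)) (at t)"
    unfolding DERIV_def tendsto_at_iff_sequentially
  proof (intro allI impI)
    fix X :: "nat \<Rightarrow> real" assume X0: "\<forall>i. X i \<in> UNIV - {0}" and X: "X \<longlonglongrightarrow> 0"
    have X0: "X i \<noteq> 0" for i using X0 by auto
    obtain b where b: "\<And>i. \<bar>X i\<bar> \<le> b"
      using convergent_imp_bounded[OF X] unfolding bounded_iff by auto
    obtain B where B: "\<And>z. z \<in> T \<Longrightarrow> norm z \<le> B" using bdd unfolding bounded_iff by auto
    \<comment> \<open>\<open>M\<close> bounds the chord ends after every shift by t + X n;
      \<open>R\<close> then bounds the norm of any point with such an abscissa and a height between
      y0 and y1.\<close>
    define M where "M = \<bar>B\<bar> + \<bar>t\<bar> + b"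
    define R where "R = M + (\<bar>y0\<bar> + \<bar>y1\<bar>)"
    from dominating[of R] obtain W :: "real \<Rightarrow> real" where W0: "integrable lborel W \<and> (\<forall>s. 0 \<le> W s) \<and>
        (\<forall>(u::real) s. s \<noteq> 0 \<and> norm (u, s) \<le> R \<longrightarrow> \<bar>k (norm (u, s))\<bar> \<le> W s)" by (rule exE)
    then have W: "integrable lborel W" "\<And>s. 0 \<le> W s"
        "\<And>u s. s \<noteq> 0 \<Longrightarrow> norm (u::real, s) \<le> R \<Longrightarrow> \<bar>k (norm (u, s))\<bar> \<le> W s" by auto
    have ae: "AE s in lborel. s \<noteq> 0 \<and> (\<forall>u. (u, s) \<in> T \<longleftrightarrow> y0 < s \<and> s < y1 \<and> fL s \<le> u \<and> u \<le> fR s) \<and>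
        (y0 < s \<and> s < y1 \<longrightarrow> fL s \<le> fR s)"
      using slice AE_lborel_singleton[of 0] by eventually_elim simp
    have main: "(\<lambda>n. (I (t + X n) s - I t s) / X n) \<longlonglongrightarrow> j s \<and> (\<forall>n. norm ((I (t + X n) s - I t s) / X n) \<le> 2 * W s)"
      if s0: "s \<noteq> 0" and sl: "\<forall>u. (u, s) \<in> T \<longleftrightarrow> y0 < s \<and> s < y1 \<and> fL s \<le> u \<and> u \<le> fR s"
        and sle: "y0 < s \<and> s < y1 \<longrightarrow> fL s \<le> fR s" for s
    proof (cases "y0 < s \<and> s < y1")
      case False
      then have "(u, s) \<notin> T" for u using sl by auto
      then have "I t s = 0" for t by (simp add: I_def)
      then show ?thesis using False W(2)[of s] by (simp add: j_def)
    next
      case True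
      obtain N where N: "\<And>x. (N has_real_derivative k (norm (x, s))) (at x)"
        using slice_antiderivative[OF s0] by blast
      have le: "fL s \<le> fR s" using sle True by simp
      then have ends: "(fL s, s) \<in> T" "(fR s, s) \<in> T" using sl True by auto
      then have bound: "\<bar>fL s\<bar> \<le> B" "\<bar>fR s\<bar> \<le> B"
        using B[OF ends(1)] B[OF ends(2)] norm_fst_le[of "fL s" s] norm_fst_le[of "fR s" s]
        unfolding real_norm_def by linarith+
      have Ieq: "I t' s = N (fR s - t') - N (fL s - t')" for t'
      proof -
        have "I t' s = (LINT u|lborel. indicator {fL s..fR s} u *\<^sub>R k (norm (u - t', s)))"
          unfolding I_def using sl True
          by (intro Bochner_Integration.integral_cong) (auto simp: indicator_def)
        also have "\<dots> = N (fR s - t') - N (fL s - t')"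
        proof (rule integral_FTC_atLeastAtMost[OF le])
          fix x
          have "((\<lambda>x. N (x - t')) has_real_derivative k (norm (x - t', s)) * 1) (at x)"
            by (rule DERIV_chain2[OF N]) (auto intro!: derivative_eq_intros)
          then show "((\<lambda>x. N (x - t')) has_vector_derivative k (norm (x - t', s))) (at x within {fL s..fR s})"
            by (simp add: has_real_derivative_iff_has_vector_derivative has_vector_derivative_at_within)
        next
          show "continuous_on {fL s..fR s} (\<lambda>u. k (norm (u - t', s)))"
            using s0 by (intro continuous_on_compose2[OF cont] continuous_intros) (auto simp: zero_prod_def)
        qed
        finally show ?thesis .
      qed
      have "((\<lambda>t. I t s) has_real_derivative (k (norm (fR s - t, s)) * (- 1) - k (norm (fL s - t, s)) * (- 1))) (at t)"
        unfolding Ieq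
        by (intro DERIV_diff DERIV_chain2[OF N]) (auto intro!: derivative_eq_intros)
      then have "((\<lambda>h. (I (t + h) s - I t s) / h) \<longlongrightarrow> j s) (at 0)"
        using True by (simp add: DERIV_def j_def)
      then have 1: "(\<lambda>n. (I (t + X n) s - I t s) / X n) \<longlonglongrightarrow> j s"
        using X X0 unfolding tendsto_at_iff_sequentially by (auto simp: o_def)
      have Nlip: "\<bar>N x - N y\<bar> \<le> W s * \<bar>x - y\<bar>" if "x \<in> {-M..M}" "y \<in> {-M..M}" for x y
      proof -
        have "norm (N x - N y) \<le> W s * norm (x - y)"
        proof (rule field_differentiable_bound[of "{-M..M}" N "\<lambda>x. k (norm (x, s))"])
          fix z assume z: "z \<in> {-M..M}"
          show "(N has_field_derivative k (norm (z, s))) (at z within {-M..M})"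
            using N by (rule has_field_derivative_at_within)
          have "norm (z, s) \<le> \<bar>z\<bar> + \<bar>s\<bar>" using norm_Pair_le[of z s] by simp
          also have "\<dots> \<le> R" using z True by (auto simp: R_def)
          finally show "norm (k (norm (z, s))) \<le> W s" using W(3)[OF s0] by simp
        qed (use that in auto)
        then show ?thesis by simp
      qed
      have "norm ((I (t + X n) s - I t s) / X n) \<le> 2 * W s" for n
      proof -
        have "\<bar>N (fR s - (t + X n)) - N (fR s - t)\<bar> \<le> W s * \<bar>(fR s - (t + X n)) - (fR s - t)\<bar>"
          using bound b[of n] by (intro Nlip) (auto simp: M_def)
        moreover have "\<bar>N (fL s - (t + X n)) - N (fL s - t)\<bar> \<le> W s * \<bar>(fL s - (t + X n)) - (fL s - t)\<bar>"
          using bound b[of n] by (intro Nlip) (auto simp: M_def)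
        ultimately have "\<bar>I (t + X n) s - I t s\<bar> \<le> 2 * W s * \<bar>X n\<bar>"
          unfolding Ieq by simp
        then show ?thesis using X0[of n] by (simp add: pos_divide_le_eq)
      qed
      then show ?thesis using 1 by blast
    qed
    have [measurable]: "I t' \<in> borel_measurable lborel" for t' using intI by (rule borel_measurable_integrable)
    have lim: "(\<lambda>n. LINT s|lborel. (I (t + X n) s - I t s) / X n) \<longlonglongrightarrow> (LINT s|lborel. j s)"
    proof (rule integral_dominated_convergence)
      show "integrable lborel (\<lambda>s. 2 * W s)" using W by simp
      show "j \<in> borel_measurable lborel" unfolding j_def by measurable
      show "AE s in lborel. (\<lambda>n. (I (t + X n) s - I t s) / X n) \<longlonglongrightarrow> j s"
        using ae by eventually_elim (use main in blast)
      show "AE s in lborel. norm ((I (t + X n) s - I t s) / X n) \<le> 2 * W s" for n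
        using ae by eventually_elim (use main in blast)
    qed measurable
    have quot: "(LINT s|lborel. (I (t + X n) s - I t s) / X n) = ((LINT s|lborel. I (t + X n) s) - (LINT s|lborel. I t s)) / X n" for n
      using intI by simp
    show "((\<lambda>h. ((LINT s|lborel. I (t + h) s) - (LINT s|lborel. I t s)) / h) \<circ> X) \<longlonglongrightarrow> (LINT s|lborel. j s)"
      using lim unfolding o_def quot .
  qed
  then show ?thesis unfolding phi j_def .
qed

lemma edge_integral:
  fixes xp yp xq yq t :: real
  assumes le: "yp < yq" and ns: "\<And>l. l \<in> {0..1} \<Longrightarrow> (xp + l * (xq - xp) - t, yp + l * (yq - yp)) \<noteq> (0, 0)"
  defines "f \<equiv> \<lambda>s. k (norm (xp + (s - yp) / (yq - yp) * (xq - xp) - t, s))"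
  shows "integrable lborel (\<lambda>s. indicator {yp<..<yq} s * f s)"
    and "(LINT s|lborel. indicator {yp<..<yq} s * f s)
      = (yq - yp) * integral {0..1} (\<lambda>l. k (norm (xp + l * (xq - xp) - t, yp + l * (yq - yp))))"
proof -
  have cf: "continuous_on {yp..yq} f"
    unfolding f_def
  proof (intro continuous_on_compose2[OF cont] continuous_intros)
    show "(\<lambda>s. norm (xp + (s - yp) / (yq - yp) * (xq - xp) - t, s)) ` {yp..yq} \<subseteq> {0<..}"
    proof (rule image_subsetI)
      fix s assume s: "s \<in> {yp..yq}"
      define l where "l = (s - yp) / (yq - yp)"
      have l: "l \<in> {0..1}" "s = yp + l * (yq - yp)" using s le by (auto simp: l_def)
      then have "(xp + l * (xq - xp) - t, s) \<noteq> (0, 0)" using ns[OF l(1)] by simp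
      then show "norm (xp + (s - yp) / (yq - yp) * (xq - xp) - t, s) \<in> {0<..}"
        unfolding l_def[symmetric] by (simp add: zero_prod_def)
    qed
  qed (use le in auto)
  have si: "set_integrable lborel {yp..yq} f"
    by (rule borel_integrable_compact[OF compact_Icc cf, folded set_integrable_def])
  have ae: "AE s in lborel. indicator {yp<..<yq} s * f s = indicator {yp..yq} s * f s"
    using AE_lborel_singleton[of yp] AE_lborel_singleton[of yq]
    by eventually_elim (auto simp: indicator_def)
  show "integrable lborel (\<lambda>s. indicator {yp<..<yq} s * f s)"
    using set_integrable_subset[OF si, of "{yp<..<yq}"] greaterThanLessThan_subseteq_atLeastAtMost_iff[of yp yq yp yq]
    by (simp add: set_integrable_def)
  have "(LINT s|lborel. indicator {yp<..<yq} s * f s) = (LINT s:{yp<..<yq}|lborel. f s)"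
    by (simp add: set_lebesgue_integral_def)
  also have "\<dots> = integral {yp<..<yq} f"
    by (rule set_borel_integral_eq_integral(2)) (rule set_integrable_subset[OF si], auto)
  also have "\<dots> = integral {yp..yq} f" by (rule integral_open_interval_real[symmetric])
  also have "\<dots> = (yq - yp) * integral {0..1} (\<lambda>l. f (yp + l * (yq - yp)))"
    using integral_unit_interval_affine[OF _ cf] le by simp
  also have "integral {0..1} (\<lambda>l. f (yp + l * (yq - yp)))
      = integral {0..1} (\<lambda>l. k (norm (xp + l * (xq - xp) - t, yp + l * (yq - yp))))"
    using le by (simp add: f_def)
  finally show "(LINT s|lborel. indicator {yp<..<yq} s * f s)
      = (yq - yp) * integral {0..1} (\<lambda>l. k (norm (xp + l * (xq - xp) - t, yp + l * (yq - yp))))" .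
qed

end

section \<open>Horizontal chords of a triangle whose vertices are sorted by height\<close>

locale sorted_triangle =
  fixes xa ya xb yb xc yc :: real and T :: "(real \<times> real) set"
  assumes ord: "yc \<le> yb" "yb \<le> ya" "yc < ya"
    and area: "(xa - xc) * (yb - yc) - (xb - xc) * (ya - yc) > 0"
    and mem: "\<And>u s. (u, s) \<in> T \<longleftrightarrow> (\<exists>a b c. 0 \<le> a \<and> 0 \<le> b \<and> 0 \<le> c \<and> a + b + c = 1 \<and>
      u = a * xa + b * xb + c * xc \<and> s = a * ya + b * yb + c * yc)"
begin

definition X :: real where "X = (xa - xc) * (yb - yc) - (xb - xc) * (ya - yc)"

text \<open>The barycentric coordinates of \<open>(u, s)\<close>, scaled by the double area \<open>X\<close>.\<close>

definition La :: "real \<Rightarrow> real \<Rightarrow> real" where "La u s = (yb - yc) * (u - xc) - (s - yc) * (xb - xc)"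
definition Lb :: "real \<Rightarrow> real \<Rightarrow> real" where "Lb u s = (s - yc) * (xa - xc) - (ya - yc) * (u - xc)"
definition Lc :: "real \<Rightarrow> real \<Rightarrow> real" where "Lc u s = (ya - yb) * (u - xb) - (s - yb) * (xa - xb)"

lemma X_pos: "X > 0"
  using area by (simp add: X_def)

lemma mem_iff: "(u, s) \<in> T \<longleftrightarrow> 0 \<le> La u s \<and> 0 \<le> Lb u s \<and> 0 \<le> Lc u s"
proof
  assume "(u, s) \<in> T"
  then obtain a b c where abc: "0 \<le> a" "0 \<le> b" "0 \<le> c" "a + b + c = 1"
    "u = a * xa + b * xb + c * xc" "s = a * ya + b * yb + c * yc"
    using mem by blast
  have c: "c = 1 - a - b" using abc(4) by simp
  have "La u s = a * X" "Lb u s = b * X" "Lc u s = c * X"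
    by (simp_all add: La_def Lb_def Lc_def X_def abc(5,6) c algebra_simps)
  then show "0 \<le> La u s \<and> 0 \<le> Lb u s \<and> 0 \<le> Lc u s" using abc X_pos by simp
next
  assume L: "0 \<le> La u s \<and> 0 \<le> Lb u s \<and> 0 \<le> Lc u s"
  have sum: "La u s + Lb u s + Lc u s = X"
    by (simp add: La_def Lb_def Lc_def X_def algebra_simps)
  have "La u s * xa + Lb u s * xb + Lc u s * xc = X * u" "La u s * ya + Lb u s * yb + Lc u s * yc = X * s"
    by (simp_all add: La_def Lb_def Lc_def X_def algebra_simps)
  then have "u = La u s / X * xa + Lb u s / X * xb + Lc u s / X * xc"
    "s = La u s / X * ya + Lb u s / X * yb + Lc u s / X * yc"
    using X_pos by (simp_all add: field_simps)
  moreover have "La u s / X + Lb u s / X + Lc u s / X = 1"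
    using X_pos sum by (simp flip: add_divide_distrib)
  ultimately show "(u, s) \<in> T"
    unfolding mem using L X_pos
    by (intro exI[of _ "La u s / X"] exI[of _ "Lb u s / X"] exI[of _ "Lc u s / X"]) auto
qed

text \<open>The height is affine in the barycentric coordinates. The first two identities confine
  the triangle to levels from \<open>yc\<close> to \<open>ya\<close>. The third tells which left
  edge is active: below \<open>yb\<close> a nonnegative \<open>La\<close> forces \<open>Lc\<close>
  to be positive, above \<open>yb\<close> it is the other way round.\<close>

lemma level_ids:
  "X * (s - yc) = La u s * (ya - yc) + Lb u s * (yb - yc)"
  "X * (ya - s) = Lb u s * (ya - yb) + Lc u s * (ya - yc)"
  "X * (s - yb) = La u s * (ya - yb) - Lc u s * (yb - yc)"
  by (simp_all add: La_def Lb_def Lc_def X_def algebra_simps)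

text \<open>The edges CA, CB and BA as graphs over the height. For a horizontal edge the division by
  zero makes \<open>f1\<close> or \<open>f2\<close> constant, which is harmless: \<open>fL\<close>
  does not select that branch at a level strictly between \<open>yc\<close> and
  \<open>ya\<close>.\<close>

definition fR :: "real \<Rightarrow> real" where "fR s = xc + (s - yc) / (ya - yc) * (xa - xc)"
definition f1 :: "real \<Rightarrow> real" where "f1 s = xc + (s - yc) / (yb - yc) * (xb - xc)"
definition f2 :: "real \<Rightarrow> real" where "f2 s = xb + (s - yb) / (ya - yb) * (xa - xb)"
definition fL :: "real \<Rightarrow> real" where "fL s = (if s < yb then f1 s else f2 s)"

lemma Lb_fR: "0 \<le> Lb u s \<longleftrightarrow> u \<le> fR s"
proof -
  have "Lb u s = (ya - yc) * (fR s - u)" using ord by (simp add: Lb_def fR_def field_simps)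
  then show ?thesis using ord by (simp add: zero_le_mult_iff)
qed

lemma La_f1: "yc < yb \<Longrightarrow> La u s = (yb - yc) * (u - f1 s)"
  by (simp add: La_def f1_def field_simps)

lemma Lc_f2: "yb < ya \<Longrightarrow> Lc u s = (ya - yb) * (u - f2 s)"
  by (simp add: Lc_def f2_def field_simps)

text \<open>The vertex levels are left out because a horizontal edge may lie there and the open
  range of levels would miss it; they form a null set.\<close>

lemma slice:
  assumes s: "s \<noteq> yc" "s \<noteq> yb" "s \<noteq> ya"
  shows "(u, s) \<in> T \<longleftrightarrow> yc < s \<and> s < ya \<and> fL s \<le> u \<and> u \<le> fR s"
    and "yc < s \<Longrightarrow> s < ya \<Longrightarrow> fL s \<le> fR s"
proof -
  have range: "yc < s \<and> s < ya" if "0 \<le> La u s" "0 \<le> Lb u s" "0 \<le> Lc u s" for u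
  proof -
    have "0 \<le> X * (s - yc)" "0 \<le> X * (ya - s)"
      using level_ids[of s u] that ord by simp_all
    then show ?thesis using X_pos s by (simp add: zero_le_mult_iff)
  qed
  have left: "0 \<le> La u s \<and> 0 \<le> Lc u s \<longleftrightarrow> fL s \<le> u" if r: "yc < s" "s < ya" for u
  proof (cases "s < yb")
    case True
    then have b: "yc < yb" using r by simp
    have "0 \<le> Lc u s" if "0 \<le> La u s"
    proof -
      have "X * (s - yb) < 0" using True X_pos by (simp add: mult_pos_neg)
      moreover have "0 \<le> La u s * (ya - yb)" using that ord by simp
      ultimately have "0 < Lc u s * (yb - yc)" using level_ids(3)[of s u] by linarith
      then show ?thesis using b by (simp add: zero_less_mult_iff)
    qed
    moreover have "0 \<le> La u s \<longleftrightarrow> fL s \<le> u"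
      using b True by (simp add: La_f1 fL_def zero_le_mult_iff)
    ultimately show ?thesis by blast
  next
    case False
    then have b: "yb < ya" "yb < s" using r s by auto
    have "0 \<le> La u s" if "0 \<le> Lc u s"
    proof -
      have "X * (s - yb) > 0" using b X_pos by simp
      moreover have "0 \<le> Lc u s * (yb - yc)" using that ord by simp
      ultimately have "0 < La u s * (ya - yb)" using level_ids(3)[of s u] by linarith
      then show ?thesis using b by (simp add: zero_less_mult_iff)
    qed
    moreover have "0 \<le> Lc u s \<longleftrightarrow> fL s \<le> u"
      using b False by (simp add: Lc_f2 fL_def zero_le_mult_iff)
    ultimately show ?thesis by blast
  qed
  show "(u, s) \<in> T \<longleftrightarrow> yc < s \<and> s < ya \<and> fL s \<le> u \<and> u \<le> fR s"
    unfolding mem_iff using range[of u] left[of u] Lb_fR[of u s] by blast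
  show "fL s \<le> fR s" if r: "yc < s" "s < ya"
  proof (cases "s < yb")
    case True
    then have b: "yc < yb" using r by simp
    have "La (f1 s) s = 0" using b by (simp add: La_f1)
    then have "0 < Lb (f1 s) s * (yb - yc)" using level_ids(1)[of s "f1 s"] mult_pos_pos[OF X_pos, of "s - yc"] r by simp
    then have "0 \<le> Lb (f1 s) s" using b by (simp add: zero_less_mult_iff)
    then show ?thesis using True Lb_fR by (simp add: fL_def)
  next
    case False
    then have b: "yb < ya" using r by simp
    have "Lc (f2 s) s = 0" using b by (simp add: Lc_f2)
    then have "0 < Lb (f2 s) s * (ya - yb)" using level_ids(2)[of s "f2 s"] mult_pos_pos[OF X_pos, of "ya - s"] r by simp
    then have "0 \<le> Lb (f2 s) s" using b by (simp add: zero_less_mult_iff)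
    then show ?thesis using False Lb_fR by (simp add: fL_def)
  qed
qed

end

context singular_kernel
begin

text \<open>Normalised in the same way as \<open>D\<close>, so that in the final argument
  \<open>D\<close> for the parameter t is the difference of \<open>J\<close> at t and at -t.\<close>

definition J :: "real \<Rightarrow> real \<Rightarrow> real \<Rightarrow> real \<Rightarrow> real \<Rightarrow> real" where
  "J t xp yp xq yq = integral {0..1} (\<lambda>l. k (norm (xp + l * (xq - xp) - t, yp + l * (yq - yp))))"

lemma triangle_potential_derivative:
  fixes T :: "(real \<times> real) set"
  assumes tri: "sorted_triangle xa ya xb yb xc yc T" and T: "bounded T" "T \<in> sets borel"
    and ns: "\<And>l. l \<in> {0..1} \<Longrightarrow> (xc + l * (xb - xc) - t, yc + l * (yb - yc)) \<noteq> (0, 0)"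
      "\<And>l. l \<in> {0..1} \<Longrightarrow> (xb + l * (xa - xb) - t, yb + l * (ya - yb)) \<noteq> (0, 0)"
      "\<And>l. l \<in> {0..1} \<Longrightarrow> (xc + l * (xa - xc) - t, yc + l * (ya - yc)) \<noteq> (0, 0)"
  shows "((\<lambda>t. LINT z|lborel. indicator T z * k (norm (z - (t, 0)))) has_real_derivative
    ((yb - yc) * J t xc yc xb yb + (ya - yb) * J t xb yb xa ya - (ya - yc) * J t xc yc xa ya)) (at t)"
proof -
  interpret sorted_triangle xa ya xb yb xc yc T by (rule tri)
  have meas: "f1 \<in> borel_measurable borel" "f2 \<in> borel_measurable borel" "fR \<in> borel_measurable borel"
    unfolding f1_def f2_def fR_def by measurable
  then have fL: "fL \<in> borel_measurable borel" unfolding fL_def by measurable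
  let ?h = "\<lambda>f s. k (norm (f s - t, s))"
  have ae: "AE s in lborel. s \<noteq> yc \<and> s \<noteq> yb \<and> s \<noteq> ya"
    using AE_lborel_singleton[of yc] AE_lborel_singleton[of yb] AE_lborel_singleton[of ya] by eventually_elim simp
  have der: "((\<lambda>t. LINT z|lborel. indicator T z * k (norm (z - (t, 0)))) has_real_derivative
    (LINT s|lborel. indicator {yc<..<ya} s * (?h fL s - ?h fR s))) (at t)"
    by (rule potential_has_derivative[OF T fL meas(3)])
       (use ae in eventually_elim, use slice in blast)
  have e1: "integrable lborel (\<lambda>s. indicator {yc<..<yb} s * ?h f1 s)"
    "(LINT s|lborel. indicator {yc<..<yb} s * ?h f1 s) = (yb - yc) * J t xc yc xb yb"
    using edge_integral[of yc yb xc xb t] ns(1) ord(1) unfolding J_def f1_def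
    by (cases "yc = yb"; simp)+
  have e2: "integrable lborel (\<lambda>s. indicator {yb<..<ya} s * ?h f2 s)"
    "(LINT s|lborel. indicator {yb<..<ya} s * ?h f2 s) = (ya - yb) * J t xb yb xa ya"
    using edge_integral[of yb ya xb xa t] ns(2) ord(2) unfolding J_def f2_def
    by (cases "ya = yb"; simp)+
  have e3: "integrable lborel (\<lambda>s. indicator {yc<..<ya} s * ?h fR s)"
    "(LINT s|lborel. indicator {yc<..<ya} s * ?h fR s) = (ya - yc) * J t xc yc xa ya"
    using edge_integral[of yc ya xc xa t] ns(3) ord(3) unfolding J_def fR_def by simp_all
  have "(LINT s|lborel. indicator {yc<..<ya} s * (?h fL s - ?h fR s))
    = (LINT s|lborel. (indicator {yc<..<yb} s * ?h f1 s + indicator {yb<..<ya} s * ?h f2 s) - indicator {yc<..<ya} s * ?h fR s)"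
  proof (rule integral_cong_AE)
    show "AE s in lborel. indicator {yc<..<ya} s * (?h fL s - ?h fR s)
      = (indicator {yc<..<yb} s * ?h f1 s + indicator {yb<..<ya} s * ?h f2 s) - indicator {yc<..<ya} s * ?h fR s"
      using ae by eventually_elim (use ord in \<open>auto simp: indicator_def fL_def\<close>)
  qed (use meas fL in measurable)
  also have "\<dots> = (yb - yc) * J t xc yc xb yb + (ya - yb) * J t xb yb xa ya - (ya - yc) * J t xc yc xa ya"
    using e1 e2 e3 by simp
  finally show ?thesis using der by simp
qed

end

section \<open>Uniqueness\<close>

lemma frame_expansion:
  fixes v n z :: "real^2"
  assumes "norm v = 1" "norm n = 1" "v \<bullet> n = 0"
  shows "z = (z \<bullet> v) *\<^sub>R v + (z \<bullet> n) *\<^sub>R n"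
proof -
  have vn: "v \<bullet> v = 1" "n \<bullet> n = 1" "n \<bullet> v = 0"
    using assms by (auto simp: norm_eq_1 inner_commute)
  obtain w :: "real^2" where w: "z = (w $ 1) *\<^sub>R v + (w $ 2) *\<^sub>R n"
    using surjD[OF orthogonal_transformation_surj[OF orthogonal_frame[OF assms]], of z] by (rule exE)
  then have "z \<bullet> v = w $ 1" "z \<bullet> n = w $ 2" by (simp_all add: inner_add_left vn assms(3))
  then show ?thesis using w by simp
qed

lemma inner_frame:
  fixes v n z w :: "real^2"
  assumes "norm v = 1" "norm n = 1" "v \<bullet> n = 0"
  shows "z \<bullet> w = (z \<bullet> v) * (w \<bullet> v) + (z \<bullet> n) * (w \<bullet> n)"
proof -
  have "z \<bullet> w = z \<bullet> ((w \<bullet> v) *\<^sub>R v + (w \<bullet> n) *\<^sub>R n)" using frame_expansion[OF assms, of w] by simp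
  then show ?thesis by (simp add: inner_add_right mult.commute)
qed

lemma norm_frame:
  fixes v n :: "real^2"
  assumes "norm v = 1" "norm n = 1" "v \<bullet> n = 0"
  shows "norm (x *\<^sub>R v + y *\<^sub>R n) = norm (x, y)"
proof -
  have vn: "v \<bullet> v = 1" "n \<bullet> n = 1" "n \<bullet> v = 0"
    using assms by (auto simp: norm_eq_1 inner_commute)
  have "(x *\<^sub>R v + y *\<^sub>R n) \<bullet> (x *\<^sub>R v + y *\<^sub>R n) = x\<^sup>2 + y\<^sup>2"
    by (simp add: inner_add_left inner_add_right vn assms(3) power2_eq_square)
  then show ?thesis by (simp add: norm_eq_sqrt_inner norm_Pair power2_eq_square)
qed

section \<open>Two distinct centers and the contradiction\<close>

definition nonobtuse_vertices :: "real^2 \<Rightarrow> real^2 \<Rightarrow> real^2 \<Rightarrow> bool" where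
  "nonobtuse_vertices A B C \<longleftrightarrow> 0 \<le> (B - A) \<bullet> (C - A) \<and> 0 \<le> (A - B) \<bullet> (C - B) \<and> 0 \<le> (A - C) \<bullet> (B - C)"

lemma min_unfolded_barycentric:
  assumes ncol: "\<not> collinear {A, B, C}" and ac: "nonobtuse_vertices A B C"
    and z: "z \<in> min_unfolded (convex hull {A, B, C})"
  obtains a b c where "a \<le> 1/2" "b \<le> 1/2" "c \<le> 1/2" "a + b + c = 1" "z = a *\<^sub>R A + b *\<^sub>R B + c *\<^sub>R C"
proof -
  obtain a b c where abc: "a + b + c = 1" "z = a *\<^sub>R A + b *\<^sub>R B + c *\<^sub>R C"
    using barycentric_coordinates_exist[OF ncol] by blast
  have "a \<le> 1/2"
    using min_unfolded_triangle_half[OF ncol refl] ac z abc unfolding nonobtuse_vertices_def by blast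
  moreover have "b \<le> 1/2"
    using min_unfolded_triangle_half[of B C A "convex hull {A, B, C}" b c a] ac z abc ncol
    unfolding nonobtuse_vertices_def by (simp add: insert_commute inner_commute add.commute add.left_commute)
  moreover have "c \<le> 1/2"
    using min_unfolded_triangle_half[of C A B "convex hull {A, B, C}" c a b] ac z abc ncol
    unfolding nonobtuse_vertices_def by (simp add: insert_commute inner_commute add.commute add.left_commute)
  ultimately show ?thesis using that abc by blast
qed

text \<open>If the same barycentric coordinate vanished at both points, the two others, at most 1/2
  with sum 1, would equal 1/2, and both points would be the same edge midpoint. So every coordinate
  becomes positive strictly between distinct points. This keeps the singularity of the kernel off
  the boundary when the derivative is taken.\<close>

lemma open_segment_min_unfolded_interior:
  fixes A B C :: "real^2"
  assumes ncol: "\<not> collinear {A, B, C}" and ac: "nonobtuse_vertices A B C"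
    and p: "p \<in> min_unfolded (convex hull {A, B, C})" and q: "q \<in> min_unfolded (convex hull {A, B, C})"
    and ne: "p \<noteq> q" and \<tau>: "0 < \<tau>" "\<tau> < 1"
  shows "(1 - \<tau>) *\<^sub>R p + \<tau> *\<^sub>R q \<in> interior (convex hull {A, B, C})"
proof -
  obtain a b c where abc: "a \<le> 1/2" "b \<le> 1/2" "c \<le> 1/2" "a + b + c = 1" "p = a *\<^sub>R A + b *\<^sub>R B + c *\<^sub>R C"
    using min_unfolded_barycentric[OF ncol ac p] .
  obtain a' b' c' where abc': "a' \<le> 1/2" "b' \<le> 1/2" "c' \<le> 1/2" "a' + b' + c' = 1" "q = a' *\<^sub>R A + b' *\<^sub>R B + c' *\<^sub>R C"
    using min_unfolded_barycentric[OF ncol ac q] .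
  have nonneg: "0 \<le> a" "0 \<le> b" "0 \<le> c" "0 \<le> a'" "0 \<le> b'" "0 \<le> c'" using abc abc' by auto
  have pos: "0 < (1 - \<tau>) * x + \<tau> * y" if "0 \<le> x" "0 \<le> y" "\<not> (x = 0 \<and> y = 0)" for x y :: real
    using that \<tau> by (cases "x = 0") (auto intro: add_pos_nonneg)
  have "\<not> (a = 0 \<and> a' = 0)"
  proof
    assume "a = 0 \<and> a' = 0"
    then have "b = b'" "c = c'" "a = a'" using abc(1-4) abc'(1-4) by auto
    then show False using ne abc(5) abc'(5) by simp
  qed
  moreover have "\<not> (b = 0 \<and> b' = 0)"
  proof
    assume "b = 0 \<and> b' = 0"
    then have "a = a'" "c = c'" "b = b'" using abc(1-4) abc'(1-4) by auto
    then show False using ne abc(5) abc'(5) by simp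
  qed
  moreover have "\<not> (c = 0 \<and> c' = 0)"
  proof
    assume "c = 0 \<and> c' = 0"
    then have "a = a'" "b = b'" "c = c'" using abc(1-4) abc'(1-4) by auto
    then show False using ne abc(5) abc'(5) by simp
  qed
  ultimately have "0 < (1 - \<tau>) * a + \<tau> * a'" "0 < (1 - \<tau>) * b + \<tau> * b'" "0 < (1 - \<tau>) * c + \<tau> * c'"
    using pos nonneg by auto
  moreover have "((1 - \<tau>) * a + \<tau> * a') + ((1 - \<tau>) * b + \<tau> * b') + ((1 - \<tau>) * c + \<tau> * c')
      = (1 - \<tau>) * (a + b + c) + \<tau> * (a' + b' + c')" by (simp add: algebra_simps)
  then have "((1 - \<tau>) * a + \<tau> * a') + ((1 - \<tau>) * b + \<tau> * b') + ((1 - \<tau>) * c + \<tau> * c') = 1"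
    unfolding abc(4) abc'(4) by simp
  moreover have "((1 - \<tau>) * a + \<tau> * a') *\<^sub>R A + ((1 - \<tau>) * b + \<tau> * b') *\<^sub>R B + ((1 - \<tau>) * c + \<tau> * c') *\<^sub>R C
      = (1 - \<tau>) *\<^sub>R p + \<tau> *\<^sub>R q"
    unfolding abc(5) abc'(5) by (simp add: algebra_simps)
  ultimately show ?thesis
    unfolding interior_convex_hull_3_minimal[OF ncol, simplified] by blast
qed

text \<open>Distance 0 is set aside: the medial triangle touches the frontier at the edge midpoints,
  so containment in it does not exclude a common point of the minimal unfolded region and the
  frontier, and the kernel has no meaning at 0.\<close>

locale unfolded_profile = singular_kernel +
  fixes \<Omega> :: "(real^2) set" and I :: "real set"
  assumes conv: "convex_on I (\<lambda>u. k (sqrt u))" and I_pos: "I \<subseteq> {0<..}"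
    and range: "\<And>z w. z \<in> min_unfolded \<Omega> \<Longrightarrow> w \<in> frontier \<Omega> \<Longrightarrow> z \<noteq> w \<Longrightarrow> (dist z w)\<^sup>2 \<in> I"
begin

lemma convex_profile: "t > 0 \<Longrightarrow> convex_profile (\<lambda>u. k (sqrt u)) I t"
proof (rule convex_profile.intro)
  show "convex_on I (\<lambda>u. k (sqrt u))" by (rule conv)
  show "strict_antimono_on I (\<lambda>u. k (sqrt u))"
    using I_pos by (intro monotone_onI antimonoD) auto
  show "continuous_on I (\<lambda>u. k (sqrt u))"
    using I_pos by (intro continuous_on_compose2[OF cont] continuous_intros) auto
qed

text \<open>All data of the contradiction are bundled so that relabelling vertices, reversing the
  normal and exchanging the centers become transformations of one predicate. The direction from p to
  q is \<open>v\<close>, and heights are measured along \<open>n\<close>.\<close>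

definition two_centers :: "real^2 \<Rightarrow> real^2 \<Rightarrow> real^2 \<Rightarrow> real^2 \<Rightarrow> real^2 \<Rightarrow> real^2 \<Rightarrow> real^2 \<Rightarrow> bool" where
  "two_centers A B C p q v n \<longleftrightarrow> \<not> collinear {A, B, C} \<and> \<Omega> = convex hull {A, B, C} \<and> nonobtuse_vertices A B C \<and>
     p \<in> min_unfolded \<Omega> \<and> q \<in> min_unfolded \<Omega> \<and> is_k_center k \<Omega> p \<and> is_k_center k \<Omega> q \<and>
     p \<noteq> q \<and> norm v = 1 \<and> norm n = 1 \<and> v \<bullet> n = 0 \<and> q - p = dist p q *\<^sub>R v"

text \<open>Signed: if \<open>A\<close> is above \<open>C\<close>, positive iff \<open>B\<close> lies to the left of the line \<open>AC\<close>.\<close>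

definition area :: "real^2 \<Rightarrow> real^2 \<Rightarrow> real^2 \<Rightarrow> real^2 \<Rightarrow> real^2 \<Rightarrow> real" where
  "area A B C v n = ((A - C) \<bullet> v) * ((B - C) \<bullet> n) - ((B - C) \<bullet> v) * ((A - C) \<bullet> n)"

lemma no_two_centers_sorted:
  assumes two: "two_centers A B C p q v n"
    and ord: "C \<bullet> n \<le> B \<bullet> n" "B \<bullet> n \<le> A \<bullet> n" "C \<bullet> n < A \<bullet> n"
    and area: "area A B C v n > 0" and CA: "C \<bullet> v \<le> A \<bullet> v"
  shows False
proof -
  have ncol: "\<not> collinear {A, B, C}" and \<Omega>: "\<Omega> = convex hull {A, B, C}" and ac: "nonobtuse_vertices A B C"
    and p: "p \<in> min_unfolded \<Omega>" "is_k_center k \<Omega> p" and q: "q \<in> min_unfolded \<Omega>" "is_k_center k \<Omega> q"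
    and ne: "p \<noteq> q" and fr: "norm v = 1" "norm n = 1" "v \<bullet> n = 0" and pq: "q - p = dist p q *\<^sub>R v"
    using two by (auto simp: two_centers_def)
  have vn: "v \<bullet> v = 1" "n \<bullet> n = 1" "n \<bullet> v = 0"
    using fr by (auto simp: norm_eq_1 inner_commute)
  define L where "L = dist p q / 2"
  have L: "L > 0" using ne by (simp add: L_def)
  define m where "m = (1/2) *\<^sub>R (p + q)"
  have qp: "q = p + (2 * L) *\<^sub>R v" using pq by (simp add: L_def algebra_simps)
  have "m = (1/2 + 1/2) *\<^sub>R p + L *\<^sub>R v"
    unfolding m_def qp by (simp only: scaleR_add_right scaleR_add_left scaleR_scaleR) simp
  then have mp: "m = p + L *\<^sub>R v" by simp
  have pm: "p = m + (- L) *\<^sub>R v" and qm: "q = m + L *\<^sub>R v"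
    unfolding mp qp by (simp_all add: add.assoc flip: scaleR_add_left)
  define x where "x z = (z - m) \<bullet> v" for z
  define y where "y z = (z - m) \<bullet> n" for z
  define F where "F u s = m + u *\<^sub>R v + s *\<^sub>R n" for u s
  have F_xy: "F (x z) (y z) = z" for z
    using frame_expansion[OF fr, of "z - m"] by (simp add: F_def x_def y_def algebra_simps)
  have xF: "x (F u s) = u" and yF: "y (F u s) = s" for u s
    by (simp_all add: F_def x_def y_def inner_add_left vn fr)
  have dF: "dist (m + t *\<^sub>R v) (F u s) = norm (u - t, s)" for t u s
  proof -
    have "dist (m + t *\<^sub>R v) (F u s) = norm ((u - t) *\<^sub>R v + s *\<^sub>R n)"
      by (simp add: F_def dist_norm norm_minus_commute algebra_simps)
    then show ?thesis by (simp add: norm_frame[OF fr])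
  qed
  have x_aff: "x (a *\<^sub>R A + b *\<^sub>R B + c *\<^sub>R C) = a * x A + b * x B + c * x C"
    and y_aff: "y (a *\<^sub>R A + b *\<^sub>R B + c *\<^sub>R C) = a * y A + b * y B + c * y C" if "a + b + c = 1" for a b c
  proof -
    have c: "c = 1 - a - b" using that by simp
    show "x (a *\<^sub>R A + b *\<^sub>R B + c *\<^sub>R C) = a * x A + b * x B + c * x C"
      "y (a *\<^sub>R A + b *\<^sub>R B + c *\<^sub>R C) = a * y A + b * y B + c * y C"
      by (simp_all add: c x_def y_def inner_add_left inner_diff_left algebra_simps)
  qed
  define T where "T = {z. F (fst z) (snd z) \<in> \<Omega>}"
  have comp: "compact \<Omega>" by (simp add: \<Omega> compact_convex_hull finite_imp_compact)
  have memT: "(u, s) \<in> T \<longleftrightarrow> (\<exists>a b c. 0 \<le> a \<and> 0 \<le> b \<and> 0 \<le> c \<and> a + b + c = 1 \<and>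
      u = a * x A + b * x B + c * x C \<and> s = a * y A + b * y B + c * y C)" for u s
  proof
    assume "(u, s) \<in> T"
    then obtain a b c where "0 \<le> a" "0 \<le> b" "0 \<le> c" "a + b + c = 1" "F u s = a *\<^sub>R A + b *\<^sub>R B + c *\<^sub>R C"
      by (auto simp: T_def \<Omega> convex_hull_3)
    moreover from this have "u = a * x A + b * x B + c * x C" "s = a * y A + b * y B + c * y C"
      using xF[of u s] yF[of u s] x_aff y_aff by auto
    ultimately show "\<exists>a b c. 0 \<le> a \<and> 0 \<le> b \<and> 0 \<le> c \<and> a + b + c = 1 \<and>
      u = a * x A + b * x B + c * x C \<and> s = a * y A + b * y B + c * y C" by blast
  next
    assume "\<exists>a b c. 0 \<le> a \<and> 0 \<le> b \<and> 0 \<le> c \<and> a + b + c = 1 \<and>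
      u = a * x A + b * x B + c * x C \<and> s = a * y A + b * y B + c * y C"
    then obtain a b c where abc: "0 \<le> a" "0 \<le> b" "0 \<le> c" "a + b + c = 1"
      "u = a * x A + b * x B + c * x C" "s = a * y A + b * y B + c * y C" by blast
    then have "F u s = a *\<^sub>R A + b *\<^sub>R B + c *\<^sub>R C"
      using F_xy[of "a *\<^sub>R A + b *\<^sub>R B + c *\<^sub>R C"] x_aff y_aff by simp
    then show "(u, s) \<in> T" using abc by (auto simp: T_def \<Omega> convex_hull_3)
  qed
  have diff: "x z - x w = (z - w) \<bullet> v" "y z - y w = (z - w) \<bullet> n" for z w
    by (simp_all add: x_def y_def inner_diff_left)
  have ordy: "y C \<le> y B" "y B \<le> y A" "y C < y A" using ord by (simp_all add: y_def inner_diff_left)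
  have areaxy: "(x A - x C) * (y B - y C) - (x B - x C) * (y A - y C) > 0"
    using area unfolding diff area_def by simp
  have tri: "sorted_triangle (x A) (y A) (x B) (y B) (x C) (y C) T"
    by unfold_locales (use ordy areaxy memT in auto)
  have contF: "continuous_on UNIV (\<lambda>z. F (fst z) (snd z))"
    unfolding F_def by (intro continuous_intros)
  have "closed T"
    using closed_vimage[OF compact_imp_closed[OF comp] contF] by (simp add: T_def vimage_def)
  then have Tb: "T \<in> sets borel" by (rule borel_closed)
  have Tbdd: "bounded T"
  proof -
    obtain B where B: "\<And>z. z \<in> \<Omega> \<Longrightarrow> dist m z \<le> B"
      using compact_imp_bounded[OF comp] unfolding bounded_any_center[where a = m] by auto
    have "norm z \<le> B" if "z \<in> T" for z
      using B[of "F (fst z) (snd z)"] dF[of 0 "fst z" "snd z"] that by (simp add: T_def)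
    then show ?thesis unfolding bounded_iff by blast
  qed
  define \<phi> where "\<phi> t = potential k \<Omega> (m + t *\<^sub>R v)" for t
  have \<Omega>b: "\<Omega> \<in> sets borel" using comp by (rule borel_compact)
  have \<phi>_eq: "\<phi> t = (LINT z|lborel. indicator T z * k (norm (z - (t, 0))))" for t
  proof -
    have meas: "(\<lambda>z. indicator \<Omega> z * k (dist (m + t *\<^sub>R v) z)) \<in> borel_measurable borel"
      unfolding dist_norm using \<Omega>b by measurable
    have "\<phi> t = (LINT (u, s)|lborel. indicator \<Omega> (F u s) * k (dist (m + t *\<^sub>R v) (F u s)))"
      unfolding \<phi>_def potential_def set_lebesgue_integral_def real_scaleR_def
      using integral_frame[OF fr meas, of m] by (simp add: F_def)
    also have "\<dots> = (LINT z|lborel. indicator T z * k (norm (z - (t, 0))))"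
      unfolding dF by (intro Bochner_Integration.integral_cong) (auto simp: T_def indicator_def)
    finally show ?thesis .
  qed
  \<comment> \<open>A point strictly between the centers stays in the minimal unfolded region by
    convexity, and off the frontier because it is interior to the triangle. Thus its squared
    distance to any boundary point lies in \<open>I\<close>, and no edge passes through the
    singularity.\<close>
  have seg: "m + t *\<^sub>R v \<in> min_unfolded \<Omega>" "m + t *\<^sub>R v \<notin> frontier \<Omega>" if "\<bar>t\<bar> < L" for t
  proof -
    define \<tau> where "\<tau> = (t + L) / (2 * L)"
    have \<tau>: "0 < \<tau>" "\<tau> < 1" using that L by (auto simp: \<tau>_def field_simps)
    have "m + t *\<^sub>R v = (1 - \<tau>) *\<^sub>R p + \<tau> *\<^sub>R q"
    proof -
      have "(1 - \<tau>) *\<^sub>R p + \<tau> *\<^sub>R q = ((1 - \<tau>) + \<tau>) *\<^sub>R m + ((1 - \<tau>) * (- L) + \<tau> * L) *\<^sub>R v"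
        unfolding pm qm by (simp only: scaleR_add_right scaleR_add_left scaleR_scaleR add_ac)
      also have "(1 - \<tau>) * (- L) + \<tau> * L = (2 * L) * \<tau> - L" by (simp add: algebra_simps)
      also have "\<dots> = t" using L by (simp add: \<tau>_def)
      finally show ?thesis by simp
    qed
    then show "m + t *\<^sub>R v \<in> min_unfolded \<Omega>" "m + t *\<^sub>R v \<notin> frontier \<Omega>"
      using convexD_alt[OF convex_min_unfolded p(1) q(1), of \<tau>] \<tau>
        open_segment_min_unfolded_interior[OF ncol ac, of p q \<tau>] p(1) q(1) ne
      unfolding \<Omega> frontier_def by auto
  qed
  have edge: "norm (x P + l * (x Q - x P) - t, y P + l * (y Q - y P)) ^ 2 \<in> I"
    if PQ: "P \<in> {A, B, C}" "Q \<in> {A, B, C}" "P \<noteq> Q" and l: "l \<in> {0..1}" and t: "\<bar>t\<bar> < L" for P Q l t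
  proof -
    define w where "w = (1 - l) *\<^sub>R P + l *\<^sub>R Q"
    have wPQ: "w \<in> closed_segment P Q" using l by (auto simp: w_def in_segment)
    have "frontier \<Omega> = closed_segment A B \<union> closed_segment B C \<union> closed_segment C A"
      unfolding \<Omega> by (rule frontier_of_triangle) simp
    then have s: "closed_segment A B \<subseteq> frontier \<Omega>" "closed_segment B C \<subseteq> frontier \<Omega>" "closed_segment C A \<subseteq> frontier \<Omega>"
      by blast+
    have s': "closed_segment B A \<subseteq> frontier \<Omega>" "closed_segment C B \<subseteq> frontier \<Omega>" "closed_segment A C \<subseteq> frontier \<Omega>"
      using s by (simp_all only: closed_segment_commute[of B A] closed_segment_commute[of C B] closed_segment_commute[of A C])
    have "closed_segment P Q \<subseteq> frontier \<Omega>"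
      using PQ s s' by (elim insertE emptyE) simp_all
    then have wf: "w \<in> frontier \<Omega>" using wPQ by blast
    have xw: "x w = x P + l * (x Q - x P)" and yw: "y w = y P + l * (y Q - y P)"
      by (simp_all add: w_def x_def y_def inner_add_left inner_diff_left algebra_simps)
    have "(dist (m + t *\<^sub>R v) w)\<^sup>2 \<in> I" using range[OF seg(1)[OF t] wf] seg(2)[OF t] wf by auto
    also have "dist (m + t *\<^sub>R v) w = norm (x w - t, y w)" using dF[of t "x w" "y w"] unfolding F_xy .
    finally show ?thesis unfolding xw yw .
  qed
  have ABC: "A \<noteq> B" "B \<noteq> C" "A \<noteq> C" using ncol by (auto simp: insert_commute)
  have ns: "(x P + l * (x Q - x P) - t, y P + l * (y Q - y P)) \<noteq> (0, 0)"
    if "P \<in> {A, B, C}" "Q \<in> {A, B, C}" "P \<noteq> Q" "l \<in> {0..1}" "\<bar>t\<bar> < L" for P Q l t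
    using edge[OF that] I_pos by (auto simp: norm_Pair)
  define \<phi>' where "\<phi>' t = (y B - y C) * J t (x C) (y C) (x B) (y B) + (y A - y B) * J t (x B) (y B) (x A) (y A)
      - (y A - y C) * J t (x C) (y C) (x A) (y A)" for t
  have der: "(\<phi> has_real_derivative \<phi>' t) (at t)" if "\<bar>t\<bar> < L" for t
    unfolding \<phi>_eq \<phi>'_def
    by (rule triangle_potential_derivative[OF tri Tbdd Tb]; rule ns) (use ABC that in auto)
  have key: "\<phi>' t - \<phi>' (- t) < 0" if t: "0 < t" "t < L" for t
  proof -
    interpret cp: convex_profile "\<lambda>u. k (sqrt u)" I t by (rule convex_profile[OF t(1)])
    have good: "cp.seg_good (x P) (y P) (x Q) (y Q)" if "P \<in> {A, B, C}" "Q \<in> {A, B, C}" "P \<noteq> Q" for P Q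
      unfolding cp.seg_good_def cp.good_def
      using edge[OF that, of _ t] edge[OF that, of _ "- t"] t by (auto simp: norm_Pair)
    have D: "cp.D (x P) (y P) (x Q) (y Q) = J t (x P) (y P) (x Q) (y Q) - J (- t) (x P) (y P) (x Q) (y Q)"
      if PQ: "P \<in> {A, B, C}" "Q \<in> {A, B, C}" "P \<noteq> Q" for P Q
    proof -
      have c: "continuous_on {0..1} (\<lambda>l. k (norm (x P + l * (x Q - x P) - t', y P + l * (y Q - y P))))"
        if "\<bar>t'\<bar> < L" for t'
        using ns[OF PQ _ that]
        by (intro continuous_on_compose2[OF cont] continuous_intros) (auto simp: zero_prod_def)
      show ?thesis
        unfolding J_def cp.D_def cp.S_def
        using t c[of t] c[of "- t"]
        by (subst Henstock_Kurzweil_Integration.integral_diff[symmetric])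
           (auto intro!: integrable_continuous_interval simp: norm_Pair)
    qed
    obtain a b c where abc: "a \<le> 1/2" "b \<le> 1/2" "c \<le> 1/2" "a + b + c = 1" "m = a *\<^sub>R A + b *\<^sub>R B + c *\<^sub>R C"
      using min_unfolded_barycentric[OF ncol ac, of m] seg(1)[of 0] L \<Omega> by auto
    have zero: "a * x A + b * x B + c * x C = 0" "a * y A + b * y B + c * y C = 0"
      using x_aff[OF abc(4)] y_aff[OF abc(4)] abc(5) by (simp_all add: x_def y_def)
    have angle: "0 \<le> (x A - x B) * (x C - x B) + (y A - y B) * (y C - y B)"
      using ac inner_frame[OF fr, of "A - B" "C - B"] unfolding diff nonobtuse_vertices_def by simp
    have CA': "x C \<le> x A" using CA by (simp add: x_def inner_diff_left)
    have "(y B - y C) * cp.D (x C) (y C) (x B) (y B) + (y A - y B) * cp.D (x B) (y B) (x A) (y A)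
        < (y A - y C) * cp.D (x C) (y C) (x A) (y A)"
      by (rule cp.triangle_edges_ineq[OF ordy areaxy angle abc(1-4) zero CA']) (use ABC good in auto)
    then show ?thesis
      using D[of C B] D[of B A] D[of C A] ABC by (simp add: \<phi>'_def algebra_simps)
  qed
  have cont\<phi>: "continuous_on S \<phi>" for S
    unfolding \<phi>_def
    by (intro continuous_on_compose2[OF continuous_potential[OF comp]] continuous_intros) (auto simp: \<Omega>)
  \<comment> \<open>The derivative is available only on the open interval: a center itself has not
    been shown to avoid the frontier. At the ends continuity of the potential suffices.\<close>
  have "\<phi> L + \<phi> (- L) < \<phi> 0 + \<phi> (- 0)"
  proof (rule DERIV_neg_imp_decreasing_open[OF L, of "\<lambda>t. \<phi> t + \<phi> (- t)"])
    fix t assume t: "0 < t" "t < L"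
    have "((\<lambda>t. \<phi> t + \<phi> (- t)) has_real_derivative (\<phi>' t + \<phi>' (- t) * (- 1))) (at t)"
      using t by (intro DERIV_add der DERIV_chain2[OF der]) (auto intro!: derivative_eq_intros)
    then show "\<exists>y. ((\<lambda>t. \<phi> t + \<phi> (- t)) has_real_derivative y) (at t) \<and> y < 0"
      using key[OF t] by (intro exI[of _ "\<phi>' t + \<phi>' (- t) * (- 1)"]) simp
  next
    show "continuous_on {0..L} (\<lambda>t. \<phi> t + \<phi> (- t))"
      by (intro continuous_intros cont\<phi> continuous_on_compose2[OF cont\<phi>[of UNIV]]) auto
  qed
  moreover have "\<phi> 0 \<le> \<phi> L" "\<phi> 0 \<le> \<phi> (- L)"
    using p(2) q(2) unfolding \<phi>_def pm[symmetric] qm[symmetric] by (auto simp: is_k_center_def)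
  ultimately show False by simp
qed

lemma two_centers_swap12: "two_centers A B C p q v n \<Longrightarrow> two_centers B A C p q v n"
  unfolding two_centers_def nonobtuse_vertices_def by (auto simp: insert_commute inner_commute)

lemma two_centers_swap23: "two_centers A B C p q v n \<Longrightarrow> two_centers A C B p q v n"
  unfolding two_centers_def nonobtuse_vertices_def by (auto simp: insert_commute inner_commute)

lemma two_centers_flip_normal: "two_centers A B C p q v n \<Longrightarrow> two_centers A B C p q v (- n)"
  unfolding two_centers_def by auto

lemma two_centers_flip_direction:
  assumes "two_centers A B C p q v n"
  shows "two_centers A B C q p (- v) n"
proof -
  have "q - p = dist p q *\<^sub>R v" using assms by (simp add: two_centers_def)
  then have "p - q = dist q p *\<^sub>R (- v)" by (simp add: dist_commute algebra_simps)
  then show ?thesis using assms unfolding two_centers_def by auto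
qed

lemma area_nonzero:
  assumes "two_centers A B C p q v n"
  shows "area A B C v n \<noteq> 0"
proof
  have fr: "norm v = 1" "norm n = 1" "v \<bullet> n = 0" and ncol: "\<not> collinear {A, B, C}"
    using assms by (auto simp: two_centers_def)
  define d where "d = A - C"
  define e where "e = B - C"
  assume "area A B C v n = 0"
  then have det: "(d \<bullet> v) * (e \<bullet> n) = (e \<bullet> v) * (d \<bullet> n)" by (simp add: area_def d_def e_def)
  have e: "e = c *\<^sub>R d" if "e \<bullet> v = c * (d \<bullet> v)" "e \<bullet> n = c * (d \<bullet> n)" for c
    using frame_expansion[OF fr, of e] frame_expansion[OF fr, of d] that
    by (metis scaleR_add_right scaleR_scaleR)
  have "d \<noteq> 0" using ncol by (auto simp: d_def insert_commute)
  then consider "d \<bullet> v \<noteq> 0" | "d \<bullet> v = 0" "d \<bullet> n \<noteq> 0"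
    using frame_expansion[OF fr, of d] by fastforce
  then have "\<exists>c. e = c *\<^sub>R d"
  proof cases
    case 1
    then show ?thesis using det by (intro exI[of _ "(e \<bullet> v) / (d \<bullet> v)"] e) (auto simp: field_simps)
  next
    case 2
    then show ?thesis using det by (intro exI[of _ "(e \<bullet> n) / (d \<bullet> n)"] e) auto
  qed
  then have "collinear {0, d, e}" by (auto simp: collinear_lemma)
  then have "collinear {A, C, B}" by (simp add: collinear_3[of A C B] d_def e_def)
  then show False using ncol by (simp add: insert_commute)
qed

text \<open>Reflection in the axis through the centers: reversing \<open>n\<close> and exchanging A
  with C preserves the order of heights and the sign of the area, but exchanges the abscissae of the
  top and bottom vertices.\<close>

lemma no_two_centers_ordered_oriented:
  assumes two: "two_centers A B C p q v n"
    and ord: "C \<bullet> n \<le> B \<bullet> n" "B \<bullet> n \<le> A \<bullet> n" "C \<bullet> n < A \<bullet> n" and area: "area A B C v n > 0"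
  shows False
proof (cases "C \<bullet> v \<le> A \<bullet> v")
  case True
  then show ?thesis using no_two_centers_sorted[OF two ord area] by simp
next
  case False
  have two': "two_centers C B A p q v (- n)"
    using two_centers_flip_normal[OF two_centers_swap12[OF two_centers_swap23[OF two_centers_swap12[OF two]]]] .
  have "area C B A v (- n) = area A B C v n"
    by (simp add: area_def inner_diff_left algebra_simps)
  then show ?thesis using no_two_centers_sorted[OF two'] ord area False by simp
qed

text \<open>Exchanging the two centers reverses \<open>v\<close> and with it the sign of the area,
  so B may be taken to lie on the left. Top and bottom heights differ strictly, since otherwise the
  area would vanish.\<close>

lemma no_two_centers_ordered:
  assumes two: "two_centers A B C p q v n" and ord: "C \<bullet> n \<le> B \<bullet> n" "B \<bullet> n \<le> A \<bullet> n"
  shows False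
proof -
  have strict: "C \<bullet> n < A \<bullet> n"
    using area_nonzero[OF two] ord by (cases "C \<bullet> n = A \<bullet> n") (auto simp: area_def inner_diff_left)
  have "area A B C (- v) n = - area A B C v n" by (simp add: area_def)
  then show ?thesis
    using area_nonzero[OF two] no_two_centers_ordered_oriented[OF two ord strict]
      no_two_centers_ordered_oriented[OF two_centers_flip_direction[OF two] ord strict] by linarith
qed

lemma no_two_centers:
  assumes two: "two_centers A B C p q v n"
  shows False
proof -
  note t1 = two_centers_swap12 and t2 = two_centers_swap23
  consider "C \<bullet> n \<le> B \<bullet> n" "B \<bullet> n \<le> A \<bullet> n" | "C \<bullet> n \<le> A \<bullet> n" "A \<bullet> n \<le> B \<bullet> n"
    | "B \<bullet> n \<le> C \<bullet> n" "C \<bullet> n \<le> A \<bullet> n" | "B \<bullet> n \<le> A \<bullet> n" "A \<bullet> n \<le> C \<bullet> n"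
    | "A \<bullet> n \<le> B \<bullet> n" "B \<bullet> n \<le> C \<bullet> n" | "A \<bullet> n \<le> C \<bullet> n" "C \<bullet> n \<le> B \<bullet> n"
    by linarith
  then show ?thesis
  proof cases
    case 1 then show ?thesis by (rule no_two_centers_ordered[OF two])
  next
    case 2 then show ?thesis by (rule no_two_centers_ordered[OF t1[OF two]])
  next
    case 3 then show ?thesis by (rule no_two_centers_ordered[OF t2[OF two]])
  next
    case 4 then show ?thesis by (rule no_two_centers_ordered[OF t1[OF t2[OF two]]])
  next
    case 5 then show ?thesis by (rule no_two_centers_ordered[OF t1[OF t2[OF t1[OF two]]]])
  next
    case 6 then show ?thesis by (rule no_two_centers_ordered[OF t2[OF t1[OF two]]])
  qed
qed

lemma unique_center:
  assumes ncol: "\<not> collinear {A, B, C}" and \<Omega>: "\<Omega> = convex hull {A, B, C}" and ac: "nonobtuse_vertices A B C"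
  shows "\<exists>!x. is_k_center k \<Omega> x"
proof -
  have comp: "compact \<Omega>" and cvx: "convex \<Omega>"
    by (simp_all add: \<Omega> compact_convex_hull finite_imp_compact)
  have int: "interior \<Omega> \<noteq> {}"
    unfolding \<Omega> interior_convex_hull_3_minimal[OF ncol, simplified]
    by (auto intro!: exI[of _ "1/3 :: real"])
  have uf: "x \<in> min_unfolded \<Omega>" if "is_k_center k \<Omega> x" for x
    by (rule center_in_min_unfolded[OF comp cvx int that])
  have "p = q" if p: "is_k_center k \<Omega> p" and q: "is_k_center k \<Omega> q" for p q
  proof (rule ccontr)
    assume ne: "p \<noteq> q"
    define v where "v = (1 / dist p q) *\<^sub>R (q - p)"
    have v: "norm v = 1" "q - p = dist p q *\<^sub>R v"
      using ne by (auto simp: v_def dist_norm norm_minus_commute)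
    obtain n where "norm n = 1" "v \<bullet> n = 0" using unit_normal_exists[OF v(1)] .
    then have "two_centers A B C p q v n"
      using ncol \<Omega> ac p q ne v uf unfolding two_centers_def by blast
    then show False by (rule no_two_centers)
  qed
  moreover have "\<Omega> \<noteq> {}" by (simp add: \<Omega>)
  ultimately show ?thesis using exists_center[OF comp cvx] by blast
qed

end

text \<open>Shrink [r, r'] by e at both ends, which lands inside the open interval, and let e tend
  to 0. The endpoints are needed because the extreme distances are themselves distances from the
  minimal unfolded region to the boundary.\<close>

lemma mono_on_closed_interval:
  fixes g :: "real \<Rightarrow> real"
  assumes cont: "continuous_on {0<..} g" and mono: "mono_on {d<..<D} g"
    and r: "0 < r" "d \<le> r" "r \<le> r'" "r' \<le> D"
  shows "g r \<le> g r'"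
proof (cases "r = r'")
  case False
  then have "r < r'" using r by simp
  have isc: "isCont g s" if "0 < s" for s
    using cont that by (simp add: continuous_on_eq_continuous_at)
  have ev: "eventually (\<lambda>e::real. e \<in> {0<..<(r' - r) / 2}) (at_right 0)"
    using \<open>r < r'\<close> by (intro eventually_at_right_real) simp
  show ?thesis
  proof (rule tendsto_le[of "at_right (0::real)"])
    show "((\<lambda>e. g (r + e)) \<longlongrightarrow> g r) (at_right 0)"
      by (rule isCont_tendsto_compose[OF isc[OF r(1)]]) (auto intro!: tendsto_eq_intros)
    show "((\<lambda>e. g (r' - e)) \<longlongrightarrow> g r') (at_right 0)"
      by (rule isCont_tendsto_compose[OF isc]) (use r in \<open>auto intro!: tendsto_eq_intros\<close>)
    show "eventually (\<lambda>e. g (r + e) \<le> g (r' - e)) (at_right 0)"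
      using ev by eventually_elim (rule mono_onD[OF mono], use r in auto)
  qed simp
qed simp

lemma min_unfolded_subset_triangle:
  assumes "\<not> collinear {A, B, C}" "nonobtuse_vertices A B C"
  shows "min_unfolded (convex hull {A, B, C}) \<subseteq> convex hull {A, B, C}"
proof
  fix z assume "z \<in> min_unfolded (convex hull {A, B, C})"
  then obtain a b c where abc: "a \<le> 1/2" "b \<le> 1/2" "c \<le> 1/2" "a + b + c = 1" "z = a *\<^sub>R A + b *\<^sub>R B + c *\<^sub>R C"
    using min_unfolded_barycentric[OF assms] by blast
  moreover have "0 \<le> a" "0 \<le> b" "0 \<le> c" using abc by auto
  ultimately show "z \<in> convex hull {A, B, C}" unfolding convex_hull_3 by blast
qed

theorem corollary4p6:
  fixes \<Omega> :: "(real^2) set" and k :: "real \<Rightarrow> real" and \<alpha> :: real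
  assumes "non_obtuse_triangle \<Omega>"
    and "strict_antimono_on {0<..} k"
    and "\<alpha> > 1" and "condition_C1 \<alpha> k"
    and "mono_on {inner_dist \<Omega><..<outer_dist \<Omega>} (\<lambda>r. deriv k r / r)"
  shows "\<exists>!x. is_k_center k \<Omega> x"
proof -
  obtain A B C where ncol: "\<not> collinear {A, B, C}" and \<Omega>: "\<Omega> = convex hull {A, B, C}"
    and ang: "vertex_angle A B C \<le> pi / 2" "vertex_angle B C A \<le> pi / 2" "vertex_angle C A B \<le> pi / 2"
    using assms(1) unfolding non_obtuse_triangle_def by blast
  have ABC: "A \<noteq> B" "B \<noteq> C" "A \<noteq> C" using ncol by (auto simp: insert_commute)
  have ac: "nonobtuse_vertices A B C"
    unfolding nonobtuse_vertices_def
    using inner_nonneg_of_vertex_angle[OF ang(1)] inner_nonneg_of_vertex_angle[OF ang(2)]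
      inner_nonneg_of_vertex_angle[OF ang(3)] ABC by (auto simp: inner_commute)
  obtain \<beta> where \<beta>: "0 < \<beta>" "\<beta> < 1" "k \<in> O[at_right 0](\<lambda>r. r powr (- \<beta>))"
    using condition_C1_bound[OF assms(3,4)] .
  obtain k' where "\<And>r. r \<in> {0<..} \<Longrightarrow> (k has_vector_derivative k' r) (at r)" and contk': "continuous_on {0<..} k'"
    using assms(4) unfolding condition_C1_def C1_differentiable_on_def by blast
  then have k': "(k has_real_derivative k' r) (at r)" if "0 < r" for r
    using that by (simp add: has_real_derivative_iff_has_vector_derivative)
  have deriv: "deriv k r = k' r" if "0 < r" for r using k'[OF that] by (rule DERIV_imp_deriv)
  have contk: "continuous_on {0<..} k"
    using k' by (intro DERIV_continuous_on[of _ _ k']) (auto intro: has_field_derivative_at_within)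
  have contg: "continuous_on {0<..} (\<lambda>r. deriv k r / r)"
  proof -
    have "continuous_on {0<..} (\<lambda>r. k' r / r)" by (intro continuous_intros contk') auto
    then show ?thesis using deriv by (subst continuous_on_cong[OF refl, of _ _ "\<lambda>r. k' r / r"]) auto
  qed
  \<comment> \<open>The squared distances between the extreme values, both included, with 0 excluded
    because the kernel lives on positive arguments.\<close>
  define I where "I = {u :: real. 0 < u \<and> inner_dist \<Omega> \<le> sqrt u \<and> sqrt u \<le> outer_dist \<Omega>}"
  interpret singular_kernel k \<beta>
    by unfold_locales (use contk assms(2) \<beta> in auto)
  interpret unfolded_profile k \<beta> \<Omega> I
  proof
    show "I \<subseteq> {0<..}" by (auto simp: I_def)
    show "convex_on I (\<lambda>u. k (sqrt u))"
    \<comment> \<open>The derivative of k (sqrt u) is k' (sqrt u) / (2 sqrt u), so the monotonicity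
      of k'(r) / r is exactly convexity in the squared distance.\<close>
    proof (rule convex_on_realI[where f' = "\<lambda>u. (deriv k (sqrt u) / sqrt u) / 2"])
      have "is_interval I"
        unfolding is_interval_1 I_def by (auto intro: order_trans[OF _ real_sqrt_le_mono] order_trans[OF real_sqrt_le_mono])
      then show "connected I" by (rule is_interval_connected)
      fix u assume u: "u \<in> I"
      then have "sqrt u > 0" "u > 0" by (auto simp: I_def)
      then have "((\<lambda>u. k (sqrt u)) has_real_derivative k' (sqrt u) * (inverse (sqrt u) / 2)) (at u)"
        by (intro DERIV_chain2[OF k'] DERIV_real_sqrt) auto
      then show "((\<lambda>u. k (sqrt u)) has_real_derivative (deriv k (sqrt u) / sqrt u) / 2) (at u)"
        using deriv[OF \<open>sqrt u > 0\<close>] by (simp add: field_simps)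
      fix u' assume u': "u' \<in> I" "u \<le> u'"
      have "deriv k (sqrt u) / sqrt u \<le> deriv k (sqrt u') / sqrt u'"
        using u u' by (intro mono_on_closed_interval[OF contg assms(5)]) (auto simp: I_def)
      then show "(deriv k (sqrt u) / sqrt u) / 2 \<le> (deriv k (sqrt u') / sqrt u') / 2" by simp
    qed
    fix z w assume z: "z \<in> min_unfolded \<Omega>" and w: "w \<in> frontier \<Omega>" and "z \<noteq> w"
    let ?S = "{dist z w |z w. z \<in> min_unfolded \<Omega> \<and> w \<in> frontier \<Omega>}"
    have comp: "compact \<Omega>" by (simp add: \<Omega> compact_convex_hull finite_imp_compact)
    have "bdd_below ?S" by (rule bdd_belowI[of _ 0]) auto
    \<comment> \<open>The supremum defining \<open>outer_dist\<close> is an upper bound only once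
      the distances are bounded; this follows because the minimal unfolded region lies in the
      triangle.\<close>
    moreover have "bdd_above ?S"
    proof (rule bdd_aboveI[of _ "diameter \<Omega>"])
      fix r assume "r \<in> ?S"
      moreover have "min_unfolded \<Omega> \<subseteq> \<Omega>" unfolding \<Omega> by (rule min_unfolded_subset_triangle[OF ncol ac])
      moreover have "frontier \<Omega> \<subseteq> \<Omega>" using compact_imp_closed[OF comp] by (rule frontier_subset_closed)
      ultimately show "r \<le> diameter \<Omega>"
        using diameter_bounded_bound[OF compact_imp_bounded[OF comp]] by blast
    qed
    moreover have "dist z w \<in> ?S" using z w by blast
    ultimately have "inner_dist \<Omega> \<le> dist z w" "dist z w \<le> outer_dist \<Omega>"
      unfolding inner_dist_def outer_dist_def by (auto intro: cInf_lower cSup_upper)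
    then show "(dist z w)\<^sup>2 \<in> I" using \<open>z \<noteq> w\<close> by (simp add: I_def)
  qed
  show ?thesis by (rule unique_center[OF ncol \<Omega> ac])
qed

end
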